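(* Let $\mathcal H$ be a real Hilbert space, let $\beta\in\,]0,+\infty[$, let $\varepsilon\in\,]0,\min\{1/2,\beta\}[$, let $x_0\in\mathcal H$, let $A\colon\mathcal H\to 2^{\mathcal H}$ be maximally monotone, and let $B\colon\mathcal H\to\mathcal H$ be $\beta$-cocoercive, i.e., $\langle x-y\mid Bx-By\rangle/\beta\geq\|Bx-By\|^2$ for all $x,y\in\mathcal H$ [this is to be read with the normalization stated in the context]. Let $(\gamma_n)_{n\in\mathbb N}$ be a sequence in $[\varepsilon,2\beta/(1+\varepsilon)]$, and let $(\mu_{n,j})_{n\in\mathbb N,\,0\leq j\leq n}$ be a real array such that: (A1) $\sup_{n\in\mathbb N}\sum_{j=0}^n|\mu_{n,j}|<+\infty$; (A2) for every $n\in\mathbb N$, $\sum_{j=0}^n\mu_{n,j}=1$; (A3) for every $j\in\mathbb N$, $\lim_{n\to+\infty}\mu_{n,j}=0$; (A4) $(\chi_n)_{n\in\mathbb N}$ is a sequence in $]0,+\infty[$ such that $\inf_{n\in\mathbb N}\chi_n>0$ and every sequence $(\xi_n)_{n\in\mathbb N}$ in $[0,+\infty[$ for which there exists a sequence $(\varepsilon_n)_{n\in\mathbb N}$ in $[0,+\infty[$ with $\sum_{n\in\mathbb N}\chi_n\varepsilon_n<+\infty$ and $\xi_{n+1}\leq\sum_{j=0}^n\mu_{n,j}\xi_j+\varepsilon_n$ for all $n\in\mathbb N$, converges. Let $(a_n)_{n\in\mathbb N}$ and $(b_n)_{n\in\mathbb N}$ be sequences in $\mathcal H$ such that $\sum_{n\in\mathbb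 N}\chi_n\|a_n\|<+\infty$ and $\sum_{n\in\mathbb N}\chi_n\|b_n\|<+\infty$. Suppose that $\operatorname{zer}(A+B)\neq\varnothing$ and that, for every $n\in\mathbb N$, $$\lambda_n\in\Big[\varepsilon,\,1+(1-\varepsilon)\Big(1-\frac{\gamma_n}{2\beta}\Big)\Big],$$ and set $\phi_n=2/(4-\gamma_n/\beta)$. For every $n\in\mathbb N$, iterate $$x_{n+1}=\overline x_n+\lambda_n\Big(J_{\gamma_nA}\big(\overline x_n-\gamma_n(B\overline x_n+b_n)\big)+a_n-\overline x_n\Big),\quad\text{where}\quad\overline x_n=\sum_{j=0}^n\mu_{n,j}x_j.$$ Suppose that one of the following is satisfied: (a) $\inf_{n\in\mathbb N}\min_{0\leq j\leq n}\mu_{n,j}\geq 0$. (b) $a_n=b_n=0$ for all $n\in\mathbb N$; there exists a sequence $(\eta_n)_{n\in\mathbb N}$ in $[0,1[$ with $\eta_0=0$ such that, for every $n\in\mathbb N$ and $j\in\{0,\ldots,n\}$, $\mu_{n,j}=1+\eta_n$ if $j=n$, $\mu_{n,j}=-\eta_n$ if $j=n-1$, and $\mu_{n,j}=0$ if $j<n-1$; for every $n\in\mathbb N$, $\chi_n=\sum_{k\geq n}\exp(\zeta_{k,n})$, where $\zeta_{k,n}=0$ if $k\leq n$ and $\zeta_{k,n}=\sum_{j=n+1}^k(\eta_j-1)$ if $k>n$; and, with $x_{-1}=x_0$, one of the following holds: (b1) $\sum_{n\in\mathbb N}\chi_n\eta_n\|x_n-x_{n-1}\|^2<+\infty$. (b2)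 $\sum_{n\in\mathbb N}n\|x_n-x_{n-1}\|^2<+\infty$ and there exists $\tau\in[2,+\infty[$ such that $\eta_n=(n-1)/(n+\tau)$ for all $n\geq 1$. (b3) $\sum_{n\in\mathbb N}\eta_n\|x_n-x_{n-1}\|^2<+\infty$ and there exists $\eta\in[0,1[$ such that $\eta_n\leq\eta$ for all $n\in\mathbb N$. (b4) With $\omega_n=1/\phi_n-\lambda_n$, there exist $(\sigma,\vartheta)\in\,]0,+\infty[^2$ and $\eta\in\,]0,1[$ such that, for every $n\in\mathbb N$, $$\eta_n\leq\eta_{n+1}\leq\eta,\qquad\lambda_n\leq\frac{\vartheta/\phi_n-\eta\big(\eta(1+\eta)+\eta\vartheta\omega_{n+1}+\sigma\big)}{\vartheta\big(1+\eta(1+\eta)+\eta\vartheta\omega_{n+1}+\sigma\big)},\qquad\frac{\eta^2(1+\eta)+\eta\sigma}{\vartheta}<\frac1{\phi_n}-\eta^2\omega_{n+1}.$$ Then the following hold: (i) $J_{\gamma_nA}(\overline x_n-\gamma_nB\overline x_n)-\overline x_n\to 0$. (ii) For every $z\in\operatorname{zer}(A+B)$, $B\overline x_n\to Bz$. (iii) There exists $x\in\operatorname{zer}(A+B)$ such that $x_n\rightharpoonup x$. (iv) Suppose that $A$ or $B$ is demiregular at every point in $\operatorname{zer}(A+B)$. Then there exists $x\in\operatorname{zer}(A+B)$ such that $x_n\to x$.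
   Context: $\mathbb N=\{0,1,2,\ldots\}$; $\rightharpoonup$ and $\to$ denote weak and strong convergence in $\mathcal H$. Normalization of cocoercivity: $B$ is $\beta$-cocoercive means $\langle x-y\mid Bx-By\rangle\geq\beta\|Bx-By\|^2$ for all $x,y\in\mathcal H$, i.e. $\langle x-y\mid Bx-By\rangle/\beta\geq\|Bx-By\|^2$. For a set-valued operator $A\colon\mathcal H\to 2^{\mathcal H}$: $\operatorname{dom}A=\{x: Ax\neq\varnothing\}$; $\operatorname{zer}A=\{x: 0\in Ax\}$; $\operatorname{gra}A=\{(x,u): u\in Ax\}$; $A$ is monotone if $\langle x-y\mid u-v\rangle\geq 0$ for all $(x,u),(y,v)\in\operatorname{gra}A$, and maximally monotone if moreover no monotone operator has a graph properly containing $\operatorname{gra}A$. The resolvent is $J_A=(\operatorname{Id}+A)^{-1}$ (single-valued and defined on all of $\mathcal H$ when $A$ is maximally monotone). An operator $A\colon\mathcal H\to 2^{\mathcal H}$ is demiregular at $x\in\operatorname{dom}A$ if, for every sequence $(x_n,u_n)_{n\in\mathbb N}$ in $\operatorname{gra}A$ and every $u\in Ax$ such that $x_n\rightharpoonup x$ and $u_n\to u$, we have $x_n\to x$; a single-valued $B$ is identified with $x\mapsto\{Bx\}$. *)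

theory Defs
  imports "HOL-Analysis.Analysis"
begin

text \<open>
  A set-valued operator on a space of type \<open>'h\<close> is a function of type \<open>'h \<Rightarrow> 'h set\<close>; a
  single-valued \<open>B\<close> is identified with \<open>\<lambda>x. {B x}\<close>. Pointwise sums of operators use the
  elementwise sum of sets from \<open>HOL-Library.Set_Algebras\<close>.
\<close>

type_synonym 'h operator = "'h \<Rightarrow> 'h set"

definition op_dom :: "'h operator \<Rightarrow> 'h set" where
  "op_dom A = {x. A x \<noteq> {}}"

definition gra :: "'h operator \<Rightarrow> ('h \<times> 'h) set" where
  "gra A = {(x, u). u \<in> A x}"

definition zer :: "'h::zero operator \<Rightarrow> 'h set" where
  "zer A = {x. 0 \<in> A x}"

definition op_inverse :: "'h operator \<Rightarrow> 'h operator" where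
  "op_inverse A = (\<lambda>u. {x. u \<in> A x})"

definition op_add :: "'h::plus operator \<Rightarrow> 'h operator \<Rightarrow> 'h operator" where
  "op_add A B = (\<lambda>x. A x + B x)"

definition op_scale :: "real \<Rightarrow> 'h::real_vector operator \<Rightarrow> 'h operator" where
  "op_scale c A = (\<lambda>x. (\<lambda>u. c *\<^sub>R u) ` A x)"

definition monotone_op :: "'h::real_inner operator \<Rightarrow> bool" where
  "monotone_op A \<longleftrightarrow> (\<forall>(x, u) \<in> gra A. \<forall>(y, v) \<in> gra A. inner (x - y) (u - v) \<ge> 0)"

definition maximally_monotone :: "'h::real_inner operator \<Rightarrow> bool" where
  "maximally_monotone A \<longleftrightarrow> monotone_op A \<and> \<not> (\<exists>A'. monotone_op A' \<and> gra A \<subset> gra A')"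

definition cocoercive :: "real \<Rightarrow> ('h::real_inner \<Rightarrow> 'h) \<Rightarrow> bool" where
  "cocoercive \<beta> B \<longleftrightarrow> (\<forall>x y. inner (x - y) (B x - B y) \<ge> \<beta> * (norm (B x - B y))\<^sup>2)"

text \<open>
  The resolvent as a point-valued map: \<open>(Id + A)\<^sup>-\<^sup>1 y\<close> is a singleton for every \<open>y\<close> when \<open>A\<close>
  is maximally monotone (Minty), and \<open>resolvent A y\<close> is its element. Otherwise the value
  is unspecified wherever \<open>(Id + A)\<^sup>-\<^sup>1 y\<close> is not a singleton.
\<close>

definition resolvent :: "'h::real_inner operator \<Rightarrow> 'h \<Rightarrow> 'h" where
  "resolvent A y = the_elem (op_inverse (op_add (\<lambda>x. {x}) A) y)"

definition weakly_converges :: "(nat \<Rightarrow> 'h::real_inner) \<Rightarrow> 'h \<Rightarrow> bool" where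
  "weakly_converges x l \<longleftrightarrow> (\<forall>y. (\<lambda>n. inner (x n) y) \<longlonglongrightarrow> inner l y)"

definition demiregular_at :: "'h::real_inner operator \<Rightarrow> 'h \<Rightarrow> bool" where
  "demiregular_at A x \<longleftrightarrow> x \<in> op_dom A \<and>
     (\<forall>(xs :: nat \<Rightarrow> 'h) us u. (\<forall>n. (xs n, us n) \<in> gra A) \<and> u \<in> A x \<and>
        weakly_converges xs x \<and> us \<longlonglongrightarrow> u \<longrightarrow> xs \<longlonglongrightarrow> x)"

definition zeta :: "(nat \<Rightarrow> real) \<Rightarrow> nat \<Rightarrow> nat \<Rightarrow> real" where
  "zeta \<eta> k n = (if k \<le> n then 0 else (\<Sum>j = n + 1..k. (\<eta> j - 1)))"

end

theory Submission
  imports Defs "HOL-Real_Asymp.Real_Asymp"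
begin

text \<open>
  Write \<open>T\<^sub>n = J (Id - \<gamma>\<^sub>n B)\<close>, with \<open>J\<close> the resolvent of \<open>\<gamma>\<^sub>n A\<close>, for the forward-backward map; its fixed points
  are the zeros of \<open>A + B\<close>. The inclusion defining the resolvent and the cocoercivity of \<open>B\<close> give
  \<open>2 \<langle>x - z, x - T\<^sub>n x\<rangle> \<ge> \<parallel>x - T\<^sub>n x\<parallel>\<^sup>2 / \<phi>\<^sub>n\<close> for every zero \<open>z\<close> (\<open>fb_residual_inequality\<close>), so the relaxed
  step from \<open>xbar\<^sub>n\<close> decreases the squared distance to \<open>z\<close> by at least \<open>\<lambda>\<^sub>n (1 / \<phi>\<^sub>n - \<lambda>\<^sub>n)\<close> times the squared
  residual, and the bounds on \<open>\<gamma>\<^sub>n\<close> and \<open>\<lambda>\<^sub>n\<close> keep this factor away from zero.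

  All conclusions follow from two facts: the distances \<open>\<parallel>x\<^sub>n - z\<parallel>\<close> converge for every zero \<open>z\<close>, and the
  residuals \<open>T\<^sub>n xbar\<^sub>n - xbar\<^sub>n\<close> tend to zero (\<open>fb_iteration_converges\<close>). Indeed small residuals
  force \<open>B xbar\<^sub>n \<rightarrow> B z\<close>; the graph of a maximally monotone operator is closed for weak convergence of the
  points combined with strong convergence of the images, hence every weak cluster point is a zero; and Opial's
  argument yields a single weak cluster point. Demiregularity turns the weak limit into a strong one.

  The two facts come from the concentrating property of the weights. With nonnegative weights it applies to
  \<open>\<parallel>x\<^sub>n - z\<parallel>\<close>, by convexity of the norm (\<open>nonneg_weights_converge\<close>). With inertial weights
  it applies to \<open>\<parallel>x\<^sub>n - z\<parallel>\<^sup>2\<close>: the extrapolation costs at most \<open>2 \<eta>\<^sub>n \<parallel>x\<^sub>n - x\<^sub>n\<^sub>-\<^sub>1\<parallel>\<^sup>2\<close>, so it is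
  enough that these costs, weighted by \<open>chi\<close>, are summable (\<open>weighted_speeds_converge\<close>). The
  remaining inertial cases reduce to this one: \<open>chi\<close> grows at most linearly for Nesterov weights and
  is bounded for inertia bounded away from one, and under the relaxation bound a Lyapunov function shows that the
  squared speeds are summable (\<open>speeds_summable_of_lyapunov\<close>). In each case the residual is bounded by a
  difference of quantities with the same limit, by Toeplitz's lemma.

  The Hilbert space background (Riesz representation and Minty's theorem) rests on a single minimization
  principle, and weak cluster points come from Tychonoff's theorem.
\<close>

section \<open>Quadratic minimization and the Riesz representation\<close>

text \<open>
  The set \<open>E\<close> plays the role of the epigraph of a convex lower semicontinuous function \<open>f\<close>;
  working with it avoids infinite values. By the parallelogram law a minimizing sequence for
  \<open>f + \<parallel>\<cdot>\<parallel>\<^sup>2 / 2\<close> is Cauchy, so completeness alone gives a minimizer \<open>w0\<close>, and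
  the conclusion is Fermat's rule: \<open>- w0\<close> is a subgradient of \<open>f\<close> at \<open>w0\<close>.
\<close>
lemma quadratic_minimizer_on_closed_convex:
  fixes E :: "('k::{real_inner, complete_space} \<times> real) set"
  assumes "closed E" and "convex E" and "E \<noteq> {}"
    and lower: "\<And>w t. (w, t) \<in> E \<Longrightarrow> m \<le> t + (norm w)\<^sup>2 / 2"
  obtains w0 t0 where "(w0, t0) \<in> E"
    and "\<And>w t. (w, t) \<in> E \<Longrightarrow> t0 - inner w0 (w - w0) \<le> t"
proof -
  define q :: "'k \<times> real \<Rightarrow> real" where "q = (\<lambda>p. snd p + (norm (fst p))\<^sup>2 / 2)"
  define I where "I = (INF p\<in>E. q p)"
  have bdd: "bdd_below (q ` E)"
    using lower by (intro bdd_belowI[where m = m]) (auto simp: q_def)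
  have I_le: "I \<le> q p" if "p \<in> E" for p
    unfolding I_def using bdd that by (rule cINF_lower)
  have "\<exists>p\<in>E. q p < I + 1 / real (Suc n)" for n
    using cINF_less_iff[OF \<open>E \<noteq> {}\<close> bdd, of "I + 1 / real (Suc n)"] by (simp add: I_def)
  then obtain p where pE: "\<And>n. p n \<in> E" and p_less: "\<And>n. q (p n) < I + 1 / real (Suc n)"
    by metis
  have q_lim: "(\<lambda>n. q (p n)) \<longlonglongrightarrow> I"
  proof (rule tendsto_sandwich)
    show "\<forall>\<^sub>F n in sequentially. I \<le> q (p n)" using I_le pE by simp
    show "\<forall>\<^sub>F n in sequentially. q (p n) \<le> I + 1 / real (Suc n)"
      using p_less by (simp add: less_imp_le)
    show "(\<lambda>n. I + 1 / real (Suc n)) \<longlonglongrightarrow> I"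
      using LIMSEQ_Suc[OF tendsto_add[OF tendsto_const lim_inverse_n', of I]] by simp
  qed simp
  have gap: "(norm (fst u - fst v))\<^sup>2 \<le> 4 * (q u - I) + 4 * (q v - I)" if "u \<in> E" "v \<in> E" for u v
  proof -
    \<comment> \<open>the midpoint cannot beat the infimum; the parallelogram law measures how much it would\<close>
    have "(1/2) *\<^sub>R u + (1/2) *\<^sub>R v \<in> E"
      using convexD[OF \<open>convex E\<close> that, of "1/2" "1/2"] by simp
    from I_le[OF this]
    have "I \<le> (q u + q v) / 2 - (norm (fst u - fst v))\<^sup>2 / 8"
      by (simp add: q_def power2_norm_eq_inner inner_simps inner_commute field_simps)
    then show ?thesis by argo
  qed
  have "Cauchy (\<lambda>n. fst (p n))"
  proof (rule metric_CauchyI)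
    fix e :: real assume "e > 0"
    then have "\<forall>\<^sub>F n in sequentially. q (p n) < I + e\<^sup>2 / 8"
      using q_lim by (intro order_tendstoD(2)[OF q_lim]) simp
    then obtain M where M: "\<And>n. n \<ge> M \<Longrightarrow> q (p n) < I + e\<^sup>2 / 8"
      by (auto simp: eventually_sequentially)
    have "dist (fst (p k)) (fst (p n)) < e" if "k \<ge> M" "n \<ge> M" for k n
    proof -
      have "(norm (fst (p k) - fst (p n)))\<^sup>2 < e\<^sup>2"
        using gap[OF pE pE, of k n] M[OF that(1)] M[OF that(2)] by argo
      then show ?thesis
        using \<open>e > 0\<close> by (simp add: dist_norm power_less_imp_less_base)
    qed
    then show "\<exists>M. \<forall>k\<ge>M. \<forall>n\<ge>M. dist (fst (p k)) (fst (p n)) < e" by blast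
  qed
  then obtain w0 where w0: "(\<lambda>n. fst (p n)) \<longlonglongrightarrow> w0"
    using Cauchy_convergent_iff convergent_def by blast
  define t0 where "t0 = I - (norm w0)\<^sup>2 / 2"
  have "(\<lambda>n. q (p n) - (norm (fst (p n)))\<^sup>2 / 2) \<longlonglongrightarrow> t0"
    unfolding t0_def by (intro tendsto_intros q_lim w0) simp
  then have "(\<lambda>n. snd (p n)) \<longlonglongrightarrow> t0" by (simp add: q_def)
  from tendsto_Pair[OF w0 this] have inE: "(w0, t0) \<in> E"
    using closed_sequentially[OF \<open>closed E\<close>, of p] pE by simp
  have vi: "t0 - inner w0 (w - w0) \<le> t" if "(w, t) \<in> E" for w t
  proof -
    have *: "0 \<le> (t - t0) + inner w0 (w - w0) + s * ((norm (w - w0))\<^sup>2 / 2)" if s: "0 < s" "s \<le> 1" for s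
    proof -
      have "(1 - s) *\<^sub>R (w0, t0) + s *\<^sub>R (w, t) \<in> E"
        using convexD[OF \<open>convex E\<close> inE \<open>(w, t) \<in> E\<close>, of "1 - s" s] s by simp
      note I_le[OF this]
      moreover have "(1 - s) *\<^sub>R w0 + s *\<^sub>R w = w0 + s *\<^sub>R (w - w0)"
        by (simp add: algebra_simps)
      moreover have "(norm (w0 + s *\<^sub>R (w - w0)))\<^sup>2
          = (norm w0)\<^sup>2 + 2 * s * inner w0 (w - w0) + s\<^sup>2 * (norm (w - w0))\<^sup>2"
        unfolding power2_norm_eq_inner
        by (simp add: inner_add_left inner_add_right inner_commute power2_eq_square)
      ultimately have "0 \<le> s * ((t - t0) + inner w0 (w - w0) + s * ((norm (w - w0))\<^sup>2 / 2))"
        by (simp add: q_def t0_def power2_eq_square dot_square_norm algebra_simps; argo)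
      then show ?thesis using s by (simp add: zero_le_mult_iff)
    qed
    have "((\<lambda>s. (t - t0) + inner w0 (w - w0) + s * ((norm (w - w0))\<^sup>2 / 2)) \<longlongrightarrow>
        (t - t0) + inner w0 (w - w0) + 0 * ((norm (w - w0))\<^sup>2 / 2)) (at_right 0)"
      by (intro tendsto_intros)
    moreover have "\<forall>\<^sub>F s in at_right (0::real). 0 \<le> (t - t0) + inner w0 (w - w0) + s * ((norm (w - w0))\<^sup>2 / 2)"
      using * eventually_at_right_less by (auto simp: eventually_at_right[of 0 1] intro!: exI[of _ 1])
    ultimately have "0 \<le> (t - t0) + inner w0 (w - w0) + 0 * ((norm (w - w0))\<^sup>2 / 2)"
      by (intro tendsto_lowerbound) auto
    then show ?thesis by simp
  qed
  show thesis using that[OF inE vi] .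
qed

text \<open>
  For \<open>f = - g\<close> the subgradient inequality of the minimizer bounds a linear form from one side, hence is an
  equality.
\<close>
lemma riesz_representation:
  fixes g :: "'k::{real_inner, complete_space} \<Rightarrow> real"
  assumes "bounded_linear g"
  obtains p where "\<And>y. g y = inner p y"
proof -
  interpret g: bounded_linear g by fact
  obtain K where K: "\<And>y. norm (g y) \<le> norm y * K" using g.bounded by blast
  define E where "E = {(w, t). - g w \<le> t}"
  have "closed E"
    unfolding E_def case_prod_beta
    by (intro closed_Collect_le continuous_intros g.continuous_on)
  moreover have "convex E"
  proof (rule convexI)
    fix p q :: "'k \<times> real" and u v :: real
    assume "p \<in> E" "q \<in> E" "0 \<le> u" "0 \<le> v" "u + v = 1"
    then have "u * - g (fst p) + v * - g (fst q) \<le> u * snd p + v * snd q"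
      by (intro add_mono mult_left_mono) (auto simp: E_def)
    then show "u *\<^sub>R p + v *\<^sub>R q \<in> E"
      by (simp add: E_def case_prod_beta g.add g.scaleR)
  qed
  moreover have "(0, 0) \<in> E" by (simp add: E_def g.zero)
  moreover have "- K\<^sup>2 / 2 \<le> t + (norm w)\<^sup>2 / 2" if "(w, t) \<in> E" for w t
    using that K[of w] zero_le_power2[of "norm w - K"]
    by (simp add: E_def power2_diff)
  ultimately obtain p t0 where pE: "(p, t0) \<in> E"
      and vi: "\<And>w t. (w, t) \<in> E \<Longrightarrow> t0 - inner p (w - p) \<le> t"
    using quadratic_minimizer_on_closed_convex[of E "- K\<^sup>2 / 2"] by blast
  have ge: "g w \<le> inner p w" for w
  proof -
    have "(p + w, - g (p + w)) \<in> E" by (simp add: E_def)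
    from vi[OF this] pE show ?thesis by (simp add: E_def g.add)
  qed
  have "g w = inner p w" for w
    using ge[of w] ge[of "- w"] by (simp add: g.neg)
  then show thesis using that by blast
qed

section \<open>Minty's theorem\<close>

text \<open>
  A point that is monotonically related to the whole graph can be added to it, so by maximality it already belongs.
\<close>
lemma maximally_monotone_mem_iff:
  assumes "maximally_monotone A"
  shows "u \<in> A x \<longleftrightarrow> (\<forall>y v. v \<in> A y \<longrightarrow> 0 \<le> inner (x - y) (u - v))"
proof
  show "\<forall>y v. v \<in> A y \<longrightarrow> 0 \<le> inner (x - y) (u - v)" if "u \<in> A x"
    using assms that by (auto simp: maximally_monotone_def monotone_op_def gra_def)
next
  assume rel: "\<forall>y v. v \<in> A y \<longrightarrow> 0 \<le> inner (x - y) (u - v)"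
  define A' where "A' = A(x := insert u (A x))"
  have gra: "gra A' = insert (x, u) (gra A)" by (auto simp: A'_def gra_def split: if_splits)
  have "0 \<le> inner (y - x) (v - u)" if "v \<in> A y" for y v
    using rel that by (metis inner_minus_left inner_minus_right minus_diff_eq minus_minus)
  then have "monotone_op A'"
    using assms rel unfolding monotone_op_def maximally_monotone_def gra
    by (auto simp: gra_def)
  then have "\<not> gra A \<subset> gra A'" using assms by (auto simp: maximally_monotone_def)
  then show "u \<in> A x" using gra by (auto simp: gra_def)
qed

text \<open>
  Minty's theorem by way of the Fitzpatrick function
  \<open>F(x, u) = sup {\<langle>x, v\<rangle> + \<langle>y, u\<rangle> - \<langle>y, v\<rangle> | (y, v) \<in> G}\<close>, whose epigraph is \<open>E\<close> below. It dominates the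
  pairing and equals it on \<open>G\<close>. If \<open>(x0, u0)\<close> minimizes \<open>F + \<parallel>\<cdot>\<parallel>\<^sup>2 / 2\<close>, the subgradient inequality at
  points of \<open>G\<close> says that \<open>(- u0, - x0)\<close> is monotonically related to \<open>G\<close>, with an excess
  \<open>\<parallel>x0 + u0\<parallel>\<^sup>2\<close>; inserting that very point forces \<open>x0 + u0 = 0\<close>.
\<close>
lemma minty_zero:
  fixes G :: "('h::{real_inner, complete_space} \<times> 'h) set"
  assumes max: "\<And>x u. (x, u) \<in> G \<longleftrightarrow> (\<forall>(y, v) \<in> G. 0 \<le> inner (x - y) (u - v))"
  obtains x where "(x, - x) \<in> G"
proof -
  define E where "E = {(w, t). \<forall>(y, v) \<in> G. inner (fst w) v + inner y (snd w) - inner y v \<le> t}"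
  have E_eq: "E = (\<Inter>(y, v)\<in>G. {p. inner (fst (fst p)) v + inner y (snd (fst p)) - inner y v \<le> snd p})"
    by (auto simp: E_def)
  have mon: "0 \<le> inner (x - y) (u - v)" if "(x, u) \<in> G" "(y, v) \<in> G" for x u y v
    using max[of x u] that by auto
  have on_graph: "((y, v), inner y v) \<in> E" if "(y, v) \<in> G" for y v
    using mon[OF that] by (fastforce simp: E_def inner_simps inner_commute)
  have "G \<noteq> {}" using max[of 0 0] by auto
  \<comment> \<open>\<open>inner x u\<close> is a lower bound of the Fitzpatrick function\<close>
  have above: "inner x u \<le> t" if "((x, u), t) \<in> E" for x u t
  proof (cases "(x, u) \<in> G")
    case True
    then show ?thesis using that by (fastforce simp: E_def)
  next
    case False
    then obtain y v where "(y, v) \<in> G" "inner (x - y) (u - v) < 0"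
      using max[of x u] by (force simp: not_le)
    moreover have "inner x v + inner y u - inner y v \<le> t"
      using that \<open>(y, v) \<in> G\<close> by (auto simp: E_def)
    ultimately show ?thesis by (simp add: inner_simps)
  qed
  have "closed E" unfolding E_eq
    by (intro closed_INT) (auto intro!: closed_Collect_le continuous_intros)
  moreover have "convex E"
  proof -
    have "convex {p::('h \<times> 'h) \<times> real. inner (fst (fst p)) v + inner y (snd (fst p)) - inner y v \<le> snd p}" for y v
    proof (rule convexI, clarsimp)
      fix a1 a2 b1 b2 :: 'h and s t u' w :: real
      assume h: "inner a1 v + inner y a2 - inner y v \<le> s" "inner b1 v + inner y b2 - inner y v \<le> t"
        "0 \<le> u'" "0 \<le> w" "u' + w = 1"
      have "u' * (inner a1 v + inner y a2 - inner y v) + w * (inner b1 v + inner y b2 - inner y v)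
          \<le> u' * s + w * t"
        using h by (intro add_mono mult_left_mono)
      moreover have "inner y v = u' * inner y v + w * inner y v"
        using h(5) by (metis distrib_right mult_1)
      ultimately show "inner (u' *\<^sub>R a1 + w *\<^sub>R b1) v + inner y (u' *\<^sub>R a2 + w *\<^sub>R b2) - inner y v
          \<le> u' * s + w * t"
        by (simp add: inner_simps algebra_simps)
    qed
    then show ?thesis unfolding E_eq by (intro convex_INT) auto
  qed
  moreover have "E \<noteq> {}" using on_graph \<open>G \<noteq> {}\<close> by fastforce
  moreover have "0 \<le> t + (norm w)\<^sup>2 / 2" if "(w, t) \<in> E" for w t
  proof -
    obtain x u where w: "w = (x, u)" by (cases w)
    have "0 \<le> (norm (x + u))\<^sup>2 / 2" by simp
    also have "\<dots> = inner x u + (norm w)\<^sup>2 / 2"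
      by (simp add: w power2_norm_eq_inner inner_simps inner_commute field_simps)
    finally show ?thesis using above[of x u t] that w by simp
  qed
  ultimately obtain w0 t0 where w0E: "(w0, t0) \<in> E"
      and vi: "\<And>w t. (w, t) \<in> E \<Longrightarrow> t0 - inner w0 (w - w0) \<le> t"
    using quadratic_minimizer_on_closed_convex[of E 0] by blast
  obtain x0 u0 where w0: "w0 = (x0, u0)" by (cases w0)
  have key: "(norm (x0 + u0))\<^sup>2 \<le> inner (y + u0) (v + x0)" if "(y, v) \<in> G" for y v
    using vi[OF on_graph[OF that]] above[of x0 u0 t0] w0E
    by (simp add: w0 power2_norm_eq_inner inner_simps inner_commute)
  have "0 \<le> inner (- u0 - y) (- x0 - v)" if "(y, v) \<in> G" for y v
  proof -
    have "inner (- u0 - y) (- x0 - v) = inner (y + u0) (v + x0)"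
      by (simp add: inner_simps inner_commute)
    then show ?thesis using key[OF that] by (simp add: order_trans[OF zero_le_power2])
  qed
  then have mem: "(- u0, - x0) \<in> G" using max by auto
  from key[OF this] have "x0 + u0 = 0" by simp
  then have "u0 = - x0" by (simp add: eq_neg_iff_add_eq_0 add.commute)
  with mem that show thesis by simp
qed

section \<open>Weak cluster points\<close>

text \<open>
  Tychonoff's theorem applied to the functionals \<open>inner (X n)\<close> in a product of compact intervals gives a
  pointwise cluster point, which is again linear and bounded, hence represented by a vector. Cluster points are
  taken along a finer filter instead of a subsequence, which avoids a reduction to separable subspaces.
\<close>
lemma bounded_weak_cluster_filter:
  fixes X :: "'i \<Rightarrow> 'h::{real_inner, complete_space}"
  assumes "F \<noteq> bot" and bound: "\<And>n. norm (X n) \<le> M"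
  obtains F' p where "F' \<noteq> bot" and "F' \<le> F"
    and "\<And>y. ((\<lambda>n. inner (X n) y) \<longlongrightarrow> inner p y) F'"
proof -
  define K :: "('h \<Rightarrow> real) set" where "K = (\<Pi>\<^sub>E y\<in>UNIV. {- (M * norm y)..M * norm y})"
  define Y where "Y n = (\<lambda>y. inner (X n) y)" for n
  have "compactin (product_topology (\<lambda>_. euclidean) UNIV) K"
    unfolding K_def by (simp add: compactin_PiE)
  then have "compact K" by (simp add: euclidean_product_topology)
  moreover have "eventually (\<lambda>g. g \<in> K) (filtermap Y F)"
  proof -
    have "\<bar>inner (X n) y\<bar> \<le> M * norm y" for n y
      using Cauchy_Schwarz_ineq2[of "X n" y] mult_right_mono[OF bound[of n], of "norm y"] by simp
    then have "Y n \<in> K" for n by (auto simp: K_def Y_def abs_le_iff minus_le_iff)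
    then show ?thesis by (simp add: eventually_filtermap)
  qed
  moreover have "filtermap Y F \<noteq> bot" using assms by (simp add: filtermap_bot_iff)
  ultimately obtain g where g: "inf (nhds g) (filtermap Y F) \<noteq> bot"
    unfolding compact_filter by blast
  \<comment> \<open>the trace on the index set of the neighbourhoods of the cluster point\<close>
  define F' where "F' = inf (filtercomap Y (nhds g)) F"
  have nonbot: "F' \<noteq> bot"
  proof
    assume "F' = bot"
    then have "eventually (\<lambda>_. False) F'" by simp
    then obtain P Q where "eventually P (filtercomap Y (nhds g))" "eventually Q F" "\<And>n. P n \<Longrightarrow> Q n \<Longrightarrow> False"
      unfolding F'_def eventually_inf by blast
    then obtain R where R: "eventually R (nhds g)" "\<And>n. R (Y n) \<Longrightarrow> P n"
      by (auto simp: eventually_filtercomap)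
    have "eventually (\<lambda>h. \<not> R h) (filtermap Y F)"
      unfolding eventually_filtermap
      by (rule eventually_mono[OF \<open>eventually Q F\<close>]) (use R \<open>\<And>n. P n \<Longrightarrow> Q n \<Longrightarrow> False\<close> in blast)
    then have "eventually (\<lambda>_. False) (inf (nhds g) (filtermap Y F))"
      unfolding eventually_inf using R(1) by blast
    then show False using g by (simp add: trivial_limit_def)
  qed
  have Y_lim: "(Y \<longlongrightarrow> g) F'"
    unfolding filterlim_def F'_def
    by (metis filtermap_filtercomap filtermap_mono inf_le1 order_trans)
  have coordinate: "((\<lambda>h. h y) \<longlongrightarrow> g y) (at g)" for y
  proof -
    have "continuous_on UNIV (\<lambda>h :: 'h \<Rightarrow> real. h y)"
      by (rule continuous_on_product_coordinates)
    then show ?thesis by (simp add: continuous_on_def)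
  qed
  have lim: "((\<lambda>n. inner (X n) y) \<longlongrightarrow> g y) F'" for y
    using tendsto_compose[OF coordinate Y_lim] by (simp add: Y_def)
  have "bounded_linear g"
  proof (rule bounded_linear_intro)
    show "g (y + z) = g y + g z" for y z
      using tendsto_add[OF lim[of y] lim[of z]] lim[of "y + z"] tendsto_unique[OF nonbot]
      by (auto simp: inner_add_right)
    show "g (c *\<^sub>R y) = c *\<^sub>R g y" for c y
      using tendsto_mult_left[OF lim[of y], of c] lim[of "c *\<^sub>R y"] tendsto_unique[OF nonbot]
      by auto
    show "norm (g y) \<le> norm y * M" for y
    proof (rule tendsto_upperbound[OF tendsto_norm[OF lim] _ nonbot])
      show "\<forall>\<^sub>F n in F'. norm (inner (X n) y) \<le> norm y * M"
        using Cauchy_Schwarz_ineq2[of "X _" y] mult_right_mono[OF bound, of "norm y"]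
        by (intro always_eventually) (auto simp: mult.commute intro: order_trans)
    qed
  qed
  then obtain p where "\<And>y. g y = inner p y" using riesz_representation by blast
  then have "((\<lambda>n. inner (X n) y) \<longlongrightarrow> inner p y) F'" for y using lim[of y] by simp
  moreover have "F' \<le> F" by (simp add: F'_def)
  ultimately show thesis using that nonbot by blast
qed

text \<open>
  If \<open>p\<close> and \<open>p'\<close> are two weak cluster points, \<open>\<parallel>X n - p'\<parallel>\<^sup>2 - \<parallel>X n - p\<parallel>\<^sup>2\<close> converges, hence so does
  \<open>inner (X n) (p - p')\<close>; comparing the limits along both filters gives \<open>p = p'\<close>. A bounded sequence with
  only one weak cluster point converges weakly to it.
\<close>
lemma opial:
  fixes X :: "nat \<Rightarrow> 'h::{real_inner, complete_space}"
  assumes "Z \<noteq> {}" and dist: "\<And>z. z \<in> Z \<Longrightarrow> convergent (\<lambda>n. norm (X n - z))"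
    and cluster: "\<And>F p. F \<noteq> bot \<Longrightarrow> F \<le> sequentially \<Longrightarrow>
      (\<And>y. ((\<lambda>n. inner (X n) y) \<longlongrightarrow> inner p y) F) \<Longrightarrow> p \<in> Z"
  shows "\<exists>p\<in>Z. weakly_converges X p"
proof -
  obtain z0 where "z0 \<in> Z" using \<open>Z \<noteq> {}\<close> by blast
  from convergent_imp_Bseq[OF dist[OF this]] obtain M where M: "\<And>n. norm (X n - z0) \<le> M"
    by (auto simp: Bseq_def)
  have bound: "norm (X n) \<le> M + norm z0" for n
    using M[of n] norm_triangle_sub[of "X n" z0] by linarith
  obtain F p where F: "F \<noteq> bot" "F \<le> sequentially" "\<And>y. ((\<lambda>n. inner (X n) y) \<longlongrightarrow> inner p y) F"
    using bounded_weak_cluster_filter[where F = sequentially and X = X, OF _ bound] by auto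
  have pZ: "p \<in> Z" using cluster F by blast
  have unique: "p' = p" if F': "F' \<noteq> bot" "F' \<le> sequentially" "\<And>y. ((\<lambda>n. inner (X n) y) \<longlongrightarrow> inner p' y) F'" for F' p'
  proof -
    have p'Z: "p' \<in> Z" using cluster F' by blast
    obtain d d' where d: "(\<lambda>n. norm (X n - p)) \<longlonglongrightarrow> d" "(\<lambda>n. norm (X n - p')) \<longlonglongrightarrow> d'"
      using dist[OF pZ] dist[OF p'Z] by (auto simp: convergent_def)
    have eq: "inner (X n) (p - p') = ((norm (X n - p'))\<^sup>2 - (norm (X n - p))\<^sup>2 + (norm p)\<^sup>2 - (norm p')\<^sup>2) / 2" for n
      by (simp add: power2_norm_eq_inner inner_simps inner_commute field_simps)
    have lim: "(\<lambda>n. inner (X n) (p - p')) \<longlonglongrightarrow> (d'\<^sup>2 - d\<^sup>2 + (norm p)\<^sup>2 - (norm p')\<^sup>2) / 2" (is "_ \<longlonglongrightarrow> ?L")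
      unfolding eq by (intro tendsto_intros d) simp
    have "inner p (p - p') = ?L"
      using tendsto_unique[OF F(1) F(3) tendsto_mono[OF F(2) lim]] .
    moreover have "inner p' (p - p') = ?L"
      using tendsto_unique[OF F'(1) F'(3) tendsto_mono[OF F'(2) lim]] .
    ultimately have "inner (p - p') (p - p') = 0" by (simp add: inner_diff_left)
    then show ?thesis by simp
  qed
  have "weakly_converges X p"
    unfolding weakly_converges_def
  proof (intro allI, rule ccontr)
    fix y assume "\<not> (\<lambda>n. inner (X n) y) \<longlonglongrightarrow> inner p y"
    then obtain e where "e > 0" and
        e: "\<not> (\<forall>\<^sub>F n in sequentially. dist (inner (X n) y) (inner p y) < e)"
      by (auto simp: tendsto_iff)
    define S where "S = {n. \<not> dist (inner (X n) y) (inner p y) < e}"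
    have "inf sequentially (principal S) \<noteq> bot"
      using e by (simp add: trivial_limit_def eventually_inf_principal S_def)
    from bounded_weak_cluster_filter[where X = X, OF this bound]
    obtain F' p' where F': "F' \<noteq> bot" "F' \<le> inf sequentially (principal S)"
      "\<And>y. ((\<lambda>n. inner (X n) y) \<longlongrightarrow> inner p' y) F'" by blast
    have "p' = p" using unique F' by (meson le_inf_iff)
    then have "\<forall>\<^sub>F n in F'. dist (inner (X n) y) (inner p y) < e"
      using F'(3)[of y] \<open>e > 0\<close> by (simp add: tendsto_iff)
    moreover have "\<forall>\<^sub>F n in F'. n \<in> S" using F'(2) by (simp add: le_principal)
    ultimately have "\<forall>\<^sub>F n in F'. False" by eventually_elim (simp add: S_def)
    then show False using F'(1) by (simp add: trivial_limit_def)
  qed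
  then show ?thesis using pZ by blast
qed

section \<open>Resolvents\<close>

text \<open>
  Minty's theorem, applied to the graph of \<open>\<gamma> A - y\<close>, provides the point; strong monotonicity of the
  identity makes it unique, so that \<^const>\<open>the_elem\<close> picks it.
\<close>
lemma resolvent_inclusion:
  fixes A :: "'h::{real_inner, complete_space} operator"
  assumes A: "maximally_monotone A" and "\<gamma> > 0"
  shows "(1 / \<gamma>) *\<^sub>R (y - resolvent (op_scale \<gamma> A) y) \<in> A (resolvent (op_scale \<gamma> A) y)"
proof -
  define G where "G = {(x, w). (1 / \<gamma>) *\<^sub>R (w + y) \<in> A x}"
  have max: "(x, w) \<in> G \<longleftrightarrow> (\<forall>(x', w') \<in> G. 0 \<le> inner (x - x') (w - w'))" for x w
  proof -
    have "(x, w) \<in> G \<longleftrightarrow> (\<forall>x' v. v \<in> A x' \<longrightarrow> 0 \<le> inner (x - x') ((1 / \<gamma>) *\<^sub>R (w + y) - v))"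
      by (simp add: G_def maximally_monotone_mem_iff[OF A, of _ x])
    also have "\<dots> \<longleftrightarrow> (\<forall>x' w'. (x', w') \<in> G \<longrightarrow> 0 \<le> inner (x - x') ((1 / \<gamma>) *\<^sub>R (w + y) - (1 / \<gamma>) *\<^sub>R (w' + y)))"
    proof (intro iffI allI impI)
      fix x' v
      assume h: "\<forall>x' w'. (x', w') \<in> G \<longrightarrow> 0 \<le> inner (x - x') ((1 / \<gamma>) *\<^sub>R (w + y) - (1 / \<gamma>) *\<^sub>R (w' + y))"
        and "v \<in> A x'"
      then have "(x', \<gamma> *\<^sub>R v - y) \<in> G" using \<open>\<gamma> > 0\<close> by (simp add: G_def)
      from h[rule_format, OF this] show "0 \<le> inner (x - x') ((1 / \<gamma>) *\<^sub>R (w + y) - v)"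
        using \<open>\<gamma> > 0\<close> by simp
    qed (simp add: G_def)
    also have "\<dots> \<longleftrightarrow> (\<forall>(x', w') \<in> G. 0 \<le> inner (x - x') (w - w'))"
      using \<open>\<gamma> > 0\<close> by (auto simp: zero_le_mult_iff zero_le_divide_iff simp flip: scaleR_diff_right)
    finally show ?thesis .
  qed
  obtain p where "(p, - p) \<in> G" using minty_zero[of G, OF max] by blast
  then have p: "(1 / \<gamma>) *\<^sub>R (y - p) \<in> A p" by (simp add: G_def algebra_simps)
  have mem_iff: "x \<in> op_inverse (op_add (\<lambda>x. {x}) (op_scale \<gamma> A)) y \<longleftrightarrow> (1 / \<gamma>) *\<^sub>R (y - x) \<in> A x" for x
  proof -
    have "x \<in> op_inverse (op_add (\<lambda>x. {x}) (op_scale \<gamma> A)) y \<longleftrightarrow> (\<exists>u\<in>A x. y = x + \<gamma> *\<^sub>R u)"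
      by (auto simp: op_inverse_def op_add_def op_scale_def set_plus_def)
    also have "\<dots> \<longleftrightarrow> (1 / \<gamma>) *\<^sub>R (y - x) \<in> A x"
      using \<open>\<gamma> > 0\<close> by (auto intro!: bexI[of _ "(1 / \<gamma>) *\<^sub>R (y - x)"])
    finally show ?thesis .
  qed
  have "x = p" if "(1 / \<gamma>) *\<^sub>R (y - x) \<in> A x" for x
  proof -
    have "0 \<le> inner (x - p) ((1 / \<gamma>) *\<^sub>R (y - x) - (1 / \<gamma>) *\<^sub>R (y - p))"
      using maximally_monotone_mem_iff[OF A] that p by blast
    also have "\<dots> = - (inner (x - p) (x - p) / \<gamma>)"
      by (simp add: inner_diff_left inner_diff_right diff_divide_distrib)
    finally have "inner (x - p) (x - p) \<le> 0"
      using \<open>\<gamma> > 0\<close> by (simp add: divide_le_0_iff)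
    then have "inner (x - p) (x - p) = 0" by (intro antisym inner_ge_zero)
    then show ?thesis by simp
  qed
  then have "op_inverse (op_add (\<lambda>x. {x}) (op_scale \<gamma> A)) y = {p}"
    using mem_iff p by blast
  then have "resolvent (op_scale \<gamma> A) y = p" by (simp add: resolvent_def)
  then show ?thesis using p by simp
qed

lemma resolvent_nonexpansive:
  fixes A :: "'h::{real_inner, complete_space} operator"
  assumes A: "maximally_monotone A" and "\<gamma> > 0"
  shows "norm (resolvent (op_scale \<gamma> A) y - resolvent (op_scale \<gamma> A) y') \<le> norm (y - y')"
proof -
  define p p' where "p = resolvent (op_scale \<gamma> A) y" and "p' = resolvent (op_scale \<gamma> A) y'"
  have "0 \<le> inner (p - p') ((1 / \<gamma>) *\<^sub>R (y - p) - (1 / \<gamma>) *\<^sub>R (y' - p'))"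
    using maximally_monotone_mem_iff[OF A] resolvent_inclusion[OF assms] unfolding p_def p'_def by blast
  then have "0 \<le> inner (p - p') ((y - p) - (y' - p'))"
    using \<open>\<gamma> > 0\<close> by (simp add: zero_le_divide_iff flip: scaleR_diff_right)
  then have "norm (p - p') * norm (p - p') \<le> inner (p - p') (y - y')"
    by (simp add: inner_diff_left inner_diff_right flip: power2_eq_square, simp add: power2_norm_eq_inner inner_simps)
  also have "\<dots> \<le> norm (p - p') * norm (y - y')"
    by (rule norm_cauchy_schwarz)
  finally show ?thesis unfolding p_def[symmetric] p'_def[symmetric]
    by (cases "p = p'") (auto dest: mult_left_le_imp_le)
qed

lemma zer_op_add_iff:
  "z \<in> zer (op_add A (\<lambda>x. {B x})) \<longleftrightarrow> - B z \<in> A z" for B :: "'h::real_vector \<Rightarrow> 'h"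
  by (auto simp: zer_def op_add_def set_plus_def eq_neg_iff_add_eq_0[symmetric] intro: bexI[of _ "- B z"])

lemma demiregular_atD:
  assumes "demiregular_at A x" and "\<And>n. us n \<in> A (xs n)" and "u \<in> A x"
    and "weakly_converges xs x" and "us \<longlonglongrightarrow> u"
  shows "xs \<longlonglongrightarrow> x"
  using assms unfolding demiregular_at_def gra_def by (simp add: Ball_def) blast

section \<open>The forward-backward map\<close>

locale forward_backward =
  fixes A :: "'h::{real_inner, complete_space} operator" and B :: "'h \<Rightarrow> 'h" and \<beta> :: real
  assumes maximal: "maximally_monotone A" and cocoercive: "cocoercive \<beta> B" and beta_pos: "\<beta> > 0"
begin

definition Z :: "'h set" where
  "Z = zer (op_add A (\<lambda>x. {B x}))"

definition fb :: "real \<Rightarrow> 'h \<Rightarrow> 'h" where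
  "fb g x = resolvent (op_scale g A) (x - g *\<^sub>R B x)"

lemma monotone: "u \<in> A x \<Longrightarrow> v \<in> A y \<Longrightarrow> 0 \<le> inner (x - y) (u - v)"
  using maximally_monotone_mem_iff[OF maximal] by blast

lemma cocoerciveD: "\<beta> * (norm (B x - B y))\<^sup>2 \<le> inner (x - y) (B x - B y)"
  using cocoercive by (simp add: cocoercive_def)

lemma fb_inclusion: "g > 0 \<Longrightarrow> (1 / g) *\<^sub>R (x - fb g x) - B x \<in> A (fb g x)"
  using resolvent_inclusion[OF maximal, of g "x - g *\<^sub>R B x"]
  by (simp add: fb_def scaleR_diff_right algebra_simps)

lemma norm_B_diff_le: "norm (B x - B y) \<le> norm (x - y) / \<beta>"
proof (cases "B x = B y")
  case False
  have "\<beta> * norm (B x - B y) * norm (B x - B y) \<le> norm (x - y) * norm (B x - B y)"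
    using cocoerciveD[of x y] norm_cauchy_schwarz[of "x - y" "B x - B y"] by (simp add: power2_eq_square)
  then have "\<beta> * norm (B x - B y) \<le> norm (x - y)" using False by simp
  then show ?thesis using beta_pos by (simp add: field_simps)
qed (use beta_pos in simp)

text \<open>
  Monotonicity of \<open>A\<close> between \<open>(fb g x, (x - fb g x) / g - B x)\<close> and \<open>(z, - B z)\<close>, plus cocoercivity. The term in
  \<open>B x - B z\<close> is kept: it is what makes \<open>B\<close> converge along the iterates.
\<close>
lemma fb_monotone_inequality:
  assumes "z \<in> Z" "g > 0"
  shows "g * \<beta> * (norm (B x - B z))\<^sup>2 + (norm (x - fb g x))\<^sup>2
    \<le> inner (x - z) (x - fb g x) + g * inner (x - fb g x) (B x - B z)"
proof -
  define r where "r = x - fb g x"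
  have "0 \<le> inner (fb g x - z) ((1 / g) *\<^sub>R r - B x - (- B z))"
    unfolding r_def
    by (rule monotone[OF fb_inclusion[OF \<open>g > 0\<close>]]) (use \<open>z \<in> Z\<close> in \<open>simp add: Z_def zer_op_add_iff\<close>)
  then have "0 \<le> g * inner (fb g x - z) ((1 / g) *\<^sub>R r - (B x - B z))"
    using \<open>g > 0\<close> by (intro mult_nonneg_nonneg) (auto simp: algebra_simps)
  also have "\<dots> = inner (x - z - r) (r - g *\<^sub>R (B x - B z))"
    using \<open>g > 0\<close> by (simp add: r_def inner_diff_right right_diff_distrib)
  finally have "0 \<le> inner (x - z) r - inner r r - g * inner (x - z) (B x - B z) + g * inner r (B x - B z)"
    by (simp only: inner_diff_left inner_diff_right inner_scaleR_right) (simp add: algebra_simps)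
  moreover have "g * (\<beta> * (norm (B x - B z))\<^sup>2) \<le> g * inner (x - z) (B x - B z)"
    using cocoerciveD[of x z] \<open>g > 0\<close> by simp
  ultimately show ?thesis by (simp add: r_def power2_norm_eq_inner mult.assoc)
qed

text \<open>
  The mixed term is absorbed by completing the square in \<open>B x - B z\<close>. Since the factor on the left is
  \<open>1 / (2 \<phi>)\<close> with \<open>\<phi> = 2 / (4 - g / \<beta>)\<close>, this says that \<open>fb g\<close> is \<open>\<phi>\<close>-averaged with respect to the zeros.
\<close>
lemma fb_residual_inequality:
  assumes "z \<in> Z" "g > 0"
  shows "(1 - g / (4 * \<beta>)) * (norm (x - fb g x))\<^sup>2 \<le> inner (x - z) (x - fb g x)"
proof -
  define r d where "r = x - fb g x" and "d = B x - B z"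
  have "0 \<le> g * \<beta> * (norm (d - (1 / (2 * \<beta>)) *\<^sub>R r))\<^sup>2"
    using beta_pos \<open>g > 0\<close> by simp
  also have "\<dots> = g * \<beta> * (norm d)\<^sup>2 - g * inner r d + g / (4 * \<beta>) * (norm r)\<^sup>2"
    using beta_pos unfolding power2_norm_eq_inner
    by (simp add: inner_diff_left inner_diff_right inner_commute field_simps)
  finally show ?thesis
    using fb_monotone_inequality[OF assms, of x] by (simp add: algebra_simps flip: r_def d_def)
qed

lemma relaxed_fb_step:
  assumes "z \<in> Z" "g > 0" "l \<ge> 0"
  shows "(norm (x + l *\<^sub>R (fb g x - x) - z))\<^sup>2
    \<le> (norm (x - z))\<^sup>2 - l * (2 - g / (2 * \<beta>) - l) * (norm (fb g x - x))\<^sup>2"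
proof -
  define r where "r = x - fb g x"
  have "x + l *\<^sub>R (fb g x - x) - z = (x - z) - l *\<^sub>R r" by (simp add: r_def algebra_simps)
  then have "(norm (x + l *\<^sub>R (fb g x - x) - z))\<^sup>2
      = (norm (x - z))\<^sup>2 - 2 * l * inner (x - z) r + l\<^sup>2 * (norm r)\<^sup>2"
    by (simp only: power2_norm_eq_inner)
      (simp add: inner_diff_left inner_diff_right inner_commute power2_eq_square algebra_simps)
  moreover have "2 * l * ((1 - g / (4 * \<beta>)) * (norm r)\<^sup>2) \<le> 2 * l * inner (x - z) r"
    using fb_residual_inequality[OF assms(1,2)] \<open>l \<ge> 0\<close> unfolding r_def by (intro mult_left_mono) auto
  ultimately show ?thesis
    by (simp add: norm_minus_commute[of "fb g x"] flip: r_def) (simp add: power2_eq_square algebra_simps)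
qed

text \<open>
  The vectors on the left lie in \<open>A (fb (g n) (X n))\<close>: this is the strong convergence of images that the
  closedness of the graph of \<open>A\<close> and demiregularity of \<open>A\<close> are applied to.
\<close>
lemma dual_limit:
  assumes "e > 0" and g: "\<And>n. e \<le> g n"
    and residual: "((\<lambda>n. fb (g n) (X n) - X n) \<longlongrightarrow> 0) F"
    and forward: "((\<lambda>n. B (X n)) \<longlongrightarrow> c) F"
  shows "((\<lambda>n. (1 / g n) *\<^sub>R (X n - fb (g n) (X n)) - B (X n)) \<longlongrightarrow> - c) F"
proof -
  have "((\<lambda>n. (1 / g n) *\<^sub>R (X n - fb (g n) (X n))) \<longlongrightarrow> 0) F"
  proof (rule Lim_null_comparison)
    show "\<forall>\<^sub>F n in F. norm ((1 / g n) *\<^sub>R (X n - fb (g n) (X n))) \<le> (1 / e) * norm (fb (g n) (X n) - X n)"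
    proof (intro always_eventually allI)
      fix n
      have "0 < g n" "1 / g n \<le> 1 / e" using g[of n] \<open>e > 0\<close> by (auto simp: frac_le intro: less_le_trans)
      then show "norm ((1 / g n) *\<^sub>R (X n - fb (g n) (X n))) \<le> (1 / e) * norm (fb (g n) (X n) - X n)"
        using mult_right_mono[of "1 / g n" "1 / e" "norm (fb (g n) (X n) - X n)"]
        by (simp add: norm_minus_commute)
    qed
    show "((\<lambda>n. (1 / e) * norm (fb (g n) (X n) - X n)) \<longlongrightarrow> 0) F"
      using tendsto_mult_right_zero[OF tendsto_norm_zero[OF residual]] .
  qed
  from tendsto_diff[OF this forward] show ?thesis by simp
qed

text \<open>
  Both steps pass to the limit in an inner product of a bounded weakly convergent and a
  strongly convergent factor: cocoercivity between \<open>X n\<close> and \<open>p\<close> gives \<open>B p = B z\<close>, and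
  monotonicity against an arbitrary point of the graph of \<open>A\<close> gives \<open>- B z \<in> A p\<close> by maximality.
\<close>
lemma zero_of_weak_limit:
  assumes "F \<noteq> bot" and "z \<in> Z" and "e > 0" and g: "\<And>n. e \<le> g n"
    and bound: "\<And>n. norm (X n) \<le> M"
    and residual: "((\<lambda>n. fb (g n) (X n) - X n) \<longlongrightarrow> 0) F"
    and forward: "((\<lambda>n. B (X n)) \<longlongrightarrow> B z) F"
    and weak: "\<And>y. ((\<lambda>n. inner (X n) y) \<longlongrightarrow> inner p y) F"
  shows "p \<in> Z"
proof -
  have weak_strong: "((\<lambda>n. inner (X n) (Y n)) \<longlongrightarrow> inner p c) F" if "(Y \<longlongrightarrow> c) F" for Y c
  proof -
    have "((\<lambda>n. M * norm (Y n - c)) \<longlongrightarrow> M * norm (c - c)) F"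
      by (intro tendsto_intros that)
    then have "((\<lambda>n. M * norm (Y n - c)) \<longlongrightarrow> 0) F" by simp
    then have "((\<lambda>n. inner (X n) (Y n - c)) \<longlongrightarrow> 0) F"
    proof (rule Lim_null_comparison[rotated])
      show "\<forall>\<^sub>F n in F. norm (inner (X n) (Y n - c)) \<le> M * norm (Y n - c)"
        using order_trans[OF Cauchy_Schwarz_ineq2 mult_right_mono[OF bound norm_ge_zero]]
        by (intro always_eventually allI) simp
    qed
    from tendsto_add[OF this weak[of c]] show ?thesis by (simp add: inner_diff_right)
  qed
  have Bp: "B p = B z"
  proof -
    have "((\<lambda>n. inner (X n) (B (X n) - B p) - inner p (B (X n) - B p)) \<longlongrightarrow>
        inner p (B z - B p) - inner p (B z - B p)) F"
      by (intro tendsto_intros weak_strong forward)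
    moreover have "((\<lambda>n. \<beta> * (norm (B (X n) - B p))\<^sup>2) \<longlongrightarrow> \<beta> * (norm (B z - B p))\<^sup>2) F"
      by (intro tendsto_intros forward)
    ultimately have "\<beta> * (norm (B z - B p))\<^sup>2 \<le> inner p (B z - B p) - inner p (B z - B p)"
      using \<open>F \<noteq> bot\<close> cocoerciveD[of "X _" p] by (intro tendsto_le) (auto simp: inner_diff_left)
    then have "(norm (B z - B p))\<^sup>2 \<le> 0" using beta_pos by (simp add: mult_le_0_iff)
    then show ?thesis by simp
  qed
  define Y where "Y n = fb (g n) (X n)" for n
  define U where "U n = (1 / g n) *\<^sub>R (X n - Y n) - B (X n)" for n
  have g_pos: "g n > 0" for n using \<open>e > 0\<close> g[of n] by linarith
  have U_in: "U n \<in> A (Y n)" for n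
    using fb_inclusion[OF g_pos[of n], of "X n"] by (simp add: U_def Y_def)
  have U_lim: "(U \<longlongrightarrow> - B z) F"
    using dual_limit[OF \<open>e > 0\<close> g residual forward] by (simp add: U_def[abs_def] Y_def)
  have "0 \<le> inner (p - w) (- B z - v)" if "v \<in> A w" for w v
  proof (rule tendsto_lowerbound[OF _ _ \<open>F \<noteq> bot\<close>])
    show "\<forall>\<^sub>F n in F. 0 \<le> inner (X n) (U n - v) + inner (Y n - X n) (U n - v) - inner w (U n - v)"
      using monotone[OF U_in that] by (intro always_eventually) (simp add: inner_diff_left)
    have "((\<lambda>n. inner (X n) (U n - v) + inner (Y n - X n) (U n - v) - inner w (U n - v)) \<longlongrightarrow>
        inner p (- B z - v) + inner 0 (- B z - v) - inner w (- B z - v)) F"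
      using residual unfolding Y_def by (intro tendsto_intros weak_strong U_lim)
    then show "((\<lambda>n. inner (X n) (U n - v) + inner (Y n - X n) (U n - v) - inner w (U n - v)) \<longlongrightarrow>
        inner (p - w) (- B z - v)) F"
      by (simp add: inner_diff_left)
  qed
  then have "- B z \<in> A p" using maximally_monotone_mem_iff[OF maximal] by blast
  then show ?thesis by (simp add: Z_def zer_op_add_iff Bp)
qed

text \<open>
  Everything that the particular averaging scheme has to provide is the convergence of the distances and the two null
  sequences. The sequences \<open>X (Suc n)\<close> and \<open>Xbar n\<close> then have the same weak cluster points.
\<close>
lemma fb_iteration_converges:
  fixes X Xbar :: "nat \<Rightarrow> 'h" and g :: "nat \<Rightarrow> real"
  assumes "Z \<noteq> {}" and "e > 0" and g: "\<And>n. e \<le> g n" "\<And>n. g n \<le> C"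
    and dist: "\<And>z. z \<in> Z \<Longrightarrow> convergent (\<lambda>n. norm (X n - z))"
    and residual: "(\<lambda>n. fb (g n) (Xbar n) - Xbar n) \<longlonglongrightarrow> 0"
    and step: "(\<lambda>n. X (Suc n) - Xbar n) \<longlonglongrightarrow> 0"
  shows "\<And>z. z \<in> Z \<Longrightarrow> (\<lambda>n. B (Xbar n)) \<longlonglongrightarrow> B z"
    and "\<exists>l\<in>Z. weakly_converges X l"
    and "(\<And>z. z \<in> Z \<Longrightarrow> demiregular_at A z \<or> demiregular_at (\<lambda>x. {B x}) z) \<Longrightarrow> \<exists>l\<in>Z. X \<longlonglongrightarrow> l"
proof -
  have g_pos: "g n > 0" for n using \<open>e > 0\<close> g(1)[of n] by linarith
  obtain M where M: "\<And>n. norm (Xbar n) \<le> M"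
  proof -
    obtain z where "z \<in> Z" using \<open>Z \<noteq> {}\<close> by blast
    obtain K where K: "\<And>n. norm (X n - z) \<le> K"
      using convergent_imp_Bseq[OF dist[OF \<open>z \<in> Z\<close>]] by (auto simp: Bseq_def)
    obtain K' where K': "\<And>n. norm (X (Suc n) - Xbar n) \<le> K'"
      using convergent_imp_Bseq[OF convergentI[OF step]] by (auto simp: Bseq_def)
    have "norm (Xbar n) \<le> K + norm z + K'" for n
    proof -
      have "Xbar n = (X (Suc n) - z) + z - (X (Suc n) - Xbar n)" by simp
      then have "norm (Xbar n) \<le> norm (X (Suc n) - z) + norm z + norm (X (Suc n) - Xbar n)"
        by (metis norm_triangle_ineq norm_triangle_ineq4 add_right_mono order_trans)
      then show ?thesis using K[of "Suc n"] K'[of n] by linarith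
    qed
    then show thesis using that by blast
  qed
  show forward: "(\<lambda>n. B (Xbar n)) \<longlonglongrightarrow> B z" if "z \<in> Z" for z
  proof -
    define r d where "r n = norm (Xbar n - fb (g n) (Xbar n))" and "d n = norm (B (Xbar n) - B z)" for n
    have r_lim: "r \<longlonglongrightarrow> 0"
      using tendsto_norm_zero[OF residual] by (simp add: r_def[abs_def] norm_minus_commute)
    define K where "K = M + norm z"
    have x_le: "norm (Xbar n - z) \<le> K" for n
      using norm_triangle_ineq4[of "Xbar n" z] M[of n] by (simp add: K_def)
    have d_le: "d n \<le> K / \<beta>" for n
      using norm_B_diff_le[of "Xbar n" z] divide_right_mono[OF x_le[of n], of \<beta>] beta_pos
      by (simp add: d_def)
    have K0: "0 \<le> K" using x_le[of 0] norm_ge_zero order_trans by blast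
    have "(d n)\<^sup>2 \<le> r n * (K + C * (K / \<beta>)) / (e * \<beta>)" for n
    proof -
      have "inner (Xbar n - z) (Xbar n - fb (g n) (Xbar n)) \<le> K * r n"
        unfolding r_def
        by (rule order_trans[OF norm_cauchy_schwarz mult_right_mono[OF x_le norm_ge_zero]])
      moreover have "g n * inner (Xbar n - fb (g n) (Xbar n)) (B (Xbar n) - B z) \<le> C * (r n * (K / \<beta>))"
      proof (rule order_trans[OF mult_left_mono mult_right_mono])
        show "inner (Xbar n - fb (g n) (Xbar n)) (B (Xbar n) - B z) \<le> r n * (K / \<beta>)"
          unfolding r_def
          by (rule order_trans[OF norm_cauchy_schwarz mult_left_mono[OF d_le[unfolded d_def] norm_ge_zero]])
        show "0 \<le> g n" using g_pos[of n] by simp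
        show "g n \<le> C" by (rule g(2))
        show "0 \<le> r n * (K / \<beta>)" using K0 beta_pos by (simp add: r_def)
      qed
      moreover have "e * \<beta> * (d n)\<^sup>2 \<le> g n * \<beta> * (d n)\<^sup>2"
        using g(1)[of n] beta_pos by (intro mult_right_mono) auto
      moreover have "r n * (K + C * (K / \<beta>)) = K * r n + C * (r n * (K / \<beta>))"
        by (simp add: algebra_simps)
      ultimately have "e * \<beta> * (d n)\<^sup>2 \<le> r n * (K + C * (K / \<beta>))"
        using fb_monotone_inequality[OF that g_pos[of n], of "Xbar n"]
          zero_le_power2[of "norm (Xbar n - fb (g n) (Xbar n))"]
        unfolding d_def by linarith
      then show ?thesis using \<open>e > 0\<close> beta_pos by (simp add: pos_le_divide_eq mult.commute)
    qed
    moreover have "(\<lambda>n. r n * (K + C * (K / \<beta>)) / (e * \<beta>)) \<longlonglongrightarrow> 0"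
      using tendsto_mult_left_zero[OF r_lim, of "(K + C * (K / \<beta>)) / (e * \<beta>)"] by simp
    ultimately have "(\<lambda>n. (d n)\<^sup>2) \<longlonglongrightarrow> 0"
      by (intro Lim_null_comparison[of "\<lambda>n. (d n)\<^sup>2"] always_eventually) simp_all
    then have "d \<longlonglongrightarrow> 0" using tendsto_real_sqrt[of "\<lambda>n. (d n)\<^sup>2" 0 sequentially] by (simp add: d_def[abs_def])
    then show ?thesis unfolding d_def by (rule LIM_zero_cancel[OF tendsto_norm_zero_cancel])
  qed
  obtain z where "z \<in> Z" using \<open>Z \<noteq> {}\<close> by blast
  have weak_Xbar: "((\<lambda>n. inner (Xbar n) y) \<longlongrightarrow> inner p y) F"
    if "F \<le> sequentially" "\<And>y. ((\<lambda>n. inner (X (Suc n)) y) \<longlongrightarrow> inner p y) F" for F p y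
  proof -
    have "((\<lambda>n. inner (X (Suc n)) y - inner (X (Suc n) - Xbar n) y) \<longlongrightarrow> inner p y - inner 0 y) F"
      using tendsto_mono[OF that(1) step] by (intro tendsto_intros that(2)) 
    then show ?thesis by (simp add: inner_diff_left)
  qed
  have "\<exists>l\<in>Z. weakly_converges (\<lambda>n. X (Suc n)) l"
  proof (rule opial[OF \<open>Z \<noteq> {}\<close>])
    show "convergent (\<lambda>n. norm (X (Suc n) - z))" if "z \<in> Z" for z
      using dist[OF that] convergent_Suc_iff[of "\<lambda>n. norm (X n - z)"] by simp
    show "p \<in> Z" if F: "F \<noteq> bot" "F \<le> sequentially"
      "\<And>y. ((\<lambda>n. inner (X (Suc n)) y) \<longlongrightarrow> inner p y) F" for F p
      using zero_of_weak_limit[where X = Xbar, OF F(1) \<open>z \<in> Z\<close> \<open>e > 0\<close> g(1) M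
          tendsto_mono[OF F(2) residual] tendsto_mono[OF F(2) forward[OF \<open>z \<in> Z\<close>]]
          weak_Xbar[OF F(2,3)]] .
  qed
  then obtain l where l: "l \<in> Z" and weak: "\<And>y. (\<lambda>n. inner (X (Suc n)) y) \<longlonglongrightarrow> inner l y"
    unfolding weakly_converges_def by blast
  have "weakly_converges X l"
    unfolding weakly_converges_def
    using weak filterlim_sequentially_Suc[of "\<lambda>n. inner (X n) _"] by (intro allI) simp
  then show "\<exists>l\<in>Z. weakly_converges X l" using l by blast
  show "\<exists>l\<in>Z. X \<longlonglongrightarrow> l"
    if demi: "\<And>z. z \<in> Z \<Longrightarrow> demiregular_at A z \<or> demiregular_at (\<lambda>x. {B x}) z"
  proof -
    have weak_bar: "weakly_converges Xbar l"
      unfolding weakly_converges_def using weak_Xbar[OF order_refl weak] by blast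
    have "Xbar \<longlonglongrightarrow> l"
      using demi[OF l]
    proof
      assume "demiregular_at (\<lambda>x. {B x}) l"
      then show ?thesis
        by (rule demiregular_atD[OF _ _ _ weak_bar forward[OF l]]) simp_all
    next
      assume D: "demiregular_at A l"
      define Y where "Y n = fb (g n) (Xbar n)" for n
      define U where "U n = (1 / g n) *\<^sub>R (Xbar n - Y n) - B (Xbar n)" for n
      have U_in: "U n \<in> A (Y n)" for n
        using fb_inclusion[OF g_pos[of n], of "Xbar n"] by (simp add: U_def Y_def)
      have U_lim: "U \<longlonglongrightarrow> - B l"
        using dual_limit[OF \<open>e > 0\<close> g(1) residual forward[OF l]] by (simp add: U_def[abs_def] Y_def)
      have "weakly_converges Y l"
        unfolding weakly_converges_def
      proof
        fix y
        have "(\<lambda>n. inner (Xbar n) y + inner (fb (g n) (Xbar n) - Xbar n) y) \<longlonglongrightarrow> inner l y + inner 0 y"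
          by (rule tendsto_add[OF weak_bar[unfolded weakly_converges_def, rule_format]
                tendsto_inner[OF residual tendsto_const]])
        then show "(\<lambda>n. inner (Y n) y) \<longlonglongrightarrow> inner l y" by (simp add: Y_def inner_diff_left)
      qed
      moreover have "- B l \<in> A l" using l by (simp add: Z_def zer_op_add_iff)
      ultimately have "Y \<longlonglongrightarrow> l" using demiregular_atD[where xs = Y and us = U, OF D U_in] U_lim by blast
      from tendsto_diff[OF this residual] show ?thesis by (simp add: Y_def)
    qed
    from tendsto_add[OF step this] have "(\<lambda>n. X (Suc n)) \<longlonglongrightarrow> l" by simp
    then show ?thesis using l filterlim_sequentially_Suc[of X "nhds l"] by auto
  qed
qed

end

section \<open>Means of scalar sequences\<close>

text \<open>
  Regularity of the summation method given by \<open>\<mu>\<close>: finitely many columns vanish in the limit, and the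
  others weigh a small error by a bounded total mass.
\<close>
lemma toeplitz_tendsto:
  fixes \<mu> :: "nat \<Rightarrow> nat \<Rightarrow> real" and \<xi> :: "nat \<Rightarrow> real"
  assumes bounded: "bdd_above (range (\<lambda>n. \<Sum>j\<le>n. \<bar>\<mu> n j\<bar>))"
    and total: "\<And>n. (\<Sum>j\<le>n. \<mu> n j) = 1"
    and column: "\<And>j. (\<lambda>n. \<mu> n j) \<longlonglongrightarrow> 0"
    and lim: "\<xi> \<longlonglongrightarrow> l"
  shows "(\<lambda>n. \<Sum>j\<le>n. \<mu> n j * \<xi> j) \<longlonglongrightarrow> l"
proof (rule LIMSEQ_I)
  fix e :: real assume "e > 0"
  obtain S where S: "\<And>n. (\<Sum>j\<le>n. \<bar>\<mu> n j\<bar>) \<le> S" using bounded by (auto simp: bdd_above_def)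
  have "S \<ge> 1" using S[of 0] sum_abs[of "\<mu> 0" "{..0}"] total[of 0] by simp
  obtain N where N: "\<And>j. j \<ge> N \<Longrightarrow> \<bar>\<xi> j - l\<bar> < e / (2 * S)"
    using LIMSEQ_D[OF lim, of "e / (2 * S)"] \<open>e > 0\<close> \<open>S \<ge> 1\<close> by (auto simp: zero_less_divide_iff)
  have "(\<lambda>n. \<Sum>j<N. \<bar>\<mu> n j\<bar> * \<bar>\<xi> j - l\<bar>) \<longlonglongrightarrow> (\<Sum>j<N. \<bar>0\<bar> * \<bar>\<xi> j - l\<bar>)"
    by (intro tendsto_intros column)
  then have "(\<lambda>n. \<Sum>j<N. \<bar>\<mu> n j\<bar> * \<bar>\<xi> j - l\<bar>) \<longlonglongrightarrow> 0" by simp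
  then obtain N' where N': "\<And>n. n \<ge> N' \<Longrightarrow> \<bar>\<Sum>j<N. \<bar>\<mu> n j\<bar> * \<bar>\<xi> j - l\<bar>\<bar> < e / 2"
    using LIMSEQ_D[of _ 0 "e / 2"] \<open>e > 0\<close> by fastforce
  have "norm ((\<Sum>j\<le>n. \<mu> n j * \<xi> j) - l) < e" if n: "n \<ge> max N N'" for n
  proof -
    have "(\<Sum>j\<le>n. \<mu> n j * \<xi> j) - l = (\<Sum>j\<le>n. \<mu> n j * (\<xi> j - l))"
      using total[of n] by (simp add: right_diff_distrib sum_subtractf flip: sum_distrib_right)
    also have "norm \<dots> \<le> (\<Sum>j\<le>n. \<bar>\<mu> n j\<bar> * \<bar>\<xi> j - l\<bar>)"
      using norm_sum[of "\<lambda>j. \<mu> n j * (\<xi> j - l)" "{..n}"] by (simp add: abs_mult)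
    also have "\<dots> = (\<Sum>j<N. \<bar>\<mu> n j\<bar> * \<bar>\<xi> j - l\<bar>) + (\<Sum>j\<in>{N..n}. \<bar>\<mu> n j\<bar> * \<bar>\<xi> j - l\<bar>)"
      using n by (subst sum.union_disjoint[symmetric]) (auto intro!: sum.cong)
    also have "(\<Sum>j\<in>{N..n}. \<bar>\<mu> n j\<bar> * \<bar>\<xi> j - l\<bar>) \<le> (\<Sum>j\<in>{N..n}. \<bar>\<mu> n j\<bar> * (e / (2 * S)))"
      using N by (intro sum_mono mult_left_mono) (auto intro: less_imp_le)
    also have "\<dots> \<le> S * (e / (2 * S))"
      unfolding sum_distrib_right[symmetric] using \<open>e > 0\<close> \<open>S \<ge> 1\<close>
      by (intro mult_right_mono order_trans[OF sum_mono2 S[of n]]) auto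
    also have "\<dots> = e / 2" using \<open>S \<ge> 1\<close> by simp
    also have "(\<Sum>j<N. \<bar>\<mu> n j\<bar> * \<bar>\<xi> j - l\<bar>) < e / 2" using N'[of n] n by simp
    finally show ?thesis by simp
  qed
  then show "\<exists>no. \<forall>n\<ge>no. norm ((\<Sum>j\<le>n. \<mu> n j * \<xi> j) - l) < e" by blast
qed

lemma null_of_square_bound:
  fixes r :: "nat \<Rightarrow> 'v::real_normed_vector"
  assumes "c > 0" and bound: "\<And>n. c * (norm (r n))\<^sup>2 \<le> u n" and "u \<longlonglongrightarrow> 0"
  shows "r \<longlonglongrightarrow> 0"
proof -
  have "(\<lambda>n. (norm (r n))\<^sup>2) \<longlonglongrightarrow> 0"
  proof (rule Lim_null_comparison)
    show "\<forall>\<^sub>F n in sequentially. norm ((norm (r n))\<^sup>2) \<le> u n / c"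
      using bound \<open>c > 0\<close> by (simp add: pos_le_divide_eq mult.commute)
    show "(\<lambda>n. u n / c) \<longlonglongrightarrow> 0" using tendsto_divide_zero[OF \<open>u \<longlonglongrightarrow> 0\<close>] .
  qed
  then have "(\<lambda>n. norm (r n)) \<longlonglongrightarrow> 0"
    using tendsto_real_sqrt[of "\<lambda>n. (norm (r n))\<^sup>2" 0 sequentially] by simp
  then show ?thesis by (rule tendsto_norm_zero_cancel)
qed

section \<open>Averaged iterations\<close>

text \<open>
  The inexact evaluations of \<open>B\<close> and of the resolvent enter only through the total error \<open>err\<close> of the step.
\<close>
locale mean_value_forward_backward = forward_backward A B \<beta>
  for A :: "'h::{real_inner, complete_space} operator" and B \<beta> +
  fixes \<epsilon> :: real and \<gamma> lam chi :: "nat \<Rightarrow> real" and \<mu> :: "nat \<Rightarrow> nat \<Rightarrow> real"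
    and x xbar err :: "nat \<Rightarrow> 'h"
  assumes eps_pos: "\<epsilon> > 0"
    and gamma: "\<And>n. \<epsilon> \<le> \<gamma> n" "\<And>n. \<gamma> n \<le> 2 * \<beta> / (1 + \<epsilon>)"
    and lam: "\<And>n. \<epsilon> \<le> lam n" "\<And>n. lam n \<le> 1 + (1 - \<epsilon>) * (1 - \<gamma> n / (2 * \<beta>))"
    and bounded: "bdd_above (range (\<lambda>n. \<Sum>j\<le>n. \<bar>\<mu> n j\<bar>))"
    and total: "\<And>n. (\<Sum>j\<le>n. \<mu> n j) = 1"
    and column: "\<And>j. (\<lambda>n. \<mu> n j) \<longlonglongrightarrow> 0"
    and chi_pos: "\<And>n. chi n > 0" and chi_Inf: "(INF n. chi n) > 0"
    and concentrating: "\<And>\<xi> e. (\<And>n. 0 \<le> \<xi> n) \<Longrightarrow> (\<And>n. 0 \<le> e n) \<Longrightarrow> summable (\<lambda>n. chi n * e n) \<Longrightarrow>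
      (\<And>n. \<xi> (Suc n) \<le> (\<Sum>j\<le>n. \<mu> n j * \<xi> j) + e n) \<Longrightarrow> convergent \<xi>"
    and zeros: "Z \<noteq> {}"
    and mean: "\<And>n. xbar n = (\<Sum>j\<le>n. \<mu> n j *\<^sub>R x j)"
    and iteration: "\<And>n. x (Suc n) = xbar n + lam n *\<^sub>R (fb (\<gamma> n) (xbar n) - xbar n) + err n"
    and err_summable: "summable (\<lambda>n. chi n * norm (err n))"
begin

abbreviation residual :: "nat \<Rightarrow> 'h" where
  "residual n \<equiv> fb (\<gamma> n) (xbar n) - xbar n"

text \<open>
  This is \<open>1 / \<phi>\<^sub>n - \<lambda>\<^sub>n\<close>, the factor that governs the decrease of the squared distance in a relaxed step.
\<close>
definition slack :: "nat \<Rightarrow> real" where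
  "slack n = 2 - \<gamma> n / (2 * \<beta>) - lam n"

lemma gamma_pos: "\<gamma> n > 0" and lam_pos: "lam n > 0"
  using eps_pos gamma(1)[of n] lam(1)[of n] by linarith+

lemma slack_ge: "\<epsilon>\<^sup>2 / (1 + \<epsilon>) \<le> slack n"
proof -
  have "\<gamma> n / (2 * \<beta>) \<le> 1 / (1 + \<epsilon>)"
    using gamma(2)[of n] beta_pos eps_pos by (simp add: field_simps)
  then have "\<epsilon> / (1 + \<epsilon>) \<le> 1 - \<gamma> n / (2 * \<beta>)" using eps_pos by (simp add: field_simps)
  then have "\<epsilon> * (\<epsilon> / (1 + \<epsilon>)) \<le> \<epsilon> * (1 - \<gamma> n / (2 * \<beta>))"
    using eps_pos by (intro mult_left_mono) auto
  moreover have "\<epsilon> * (1 - \<gamma> n / (2 * \<beta>)) \<le> slack n"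
    using lam(2)[of n] by (simp add: slack_def algebra_simps diff_divide_distrib)
  ultimately show ?thesis by (simp add: power2_eq_square)
qed

lemma slack_pos: "slack n > 0"
  by (rule less_le_trans[OF _ slack_ge]) (use eps_pos in simp)

text \<open>
  A lower bound, uniform in \<open>n\<close>, of the coefficient \<open>lam n * slack n\<close> of the squared residual.
\<close>
definition margin :: real where
  "margin = \<epsilon> * (\<epsilon>\<^sup>2 / (1 + \<epsilon>))"

lemma margin_pos: "margin > 0"
  using eps_pos by (simp add: margin_def)

lemma margin_le: "margin \<le> lam n * slack n"
  unfolding margin_def using lam(1)[of n] slack_ge[of n] eps_pos lam_pos[of n]
  by (intro mult_mono) auto

lemma lam_le_2: "lam n \<le> 2"
  using slack_pos[of n] gamma_pos[of n] beta_pos unfolding slack_def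
  by (smt (verit) divide_pos_pos)

lemma exact_step:
  assumes "z \<in> Z"
  shows "(norm (xbar n + lam n *\<^sub>R residual n - z))\<^sup>2
    \<le> (norm (xbar n - z))\<^sup>2 - lam n * slack n * (norm (residual n))\<^sup>2"
  using relaxed_fb_step[OF assms gamma_pos less_imp_le[OF lam_pos]] unfolding slack_def .

lemma exact_step_margin:
  assumes "z \<in> Z"
  shows "(norm (xbar n + lam n *\<^sub>R residual n - z))\<^sup>2 + margin * (norm (residual n))\<^sup>2
    \<le> (norm (xbar n - z))\<^sup>2"
  using exact_step[OF assms, of n] mult_right_mono[OF margin_le[of n], of "(norm (residual n))\<^sup>2"] by simp

lemma null_of_summable:
  assumes "summable (\<lambda>n. chi n * e n)" and nonneg: "\<And>n. 0 \<le> e n"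
  shows "e \<longlonglongrightarrow> 0"
proof (rule Lim_null_comparison)
  define m where "m = (INF n. chi n)"
  have m: "m > 0" "\<And>n. m \<le> chi n"
    unfolding m_def using chi_Inf chi_pos
    by (auto intro!: cINF_lower bdd_belowI[of _ 0] intro: less_imp_le)
  show "\<forall>\<^sub>F n in sequentially. norm (e n) \<le> chi n * e n / m"
    using m nonneg by (intro always_eventually) (simp add: pos_le_divide_eq mult.commute mult_right_mono)
  show "(\<lambda>n. chi n * e n / m) \<longlonglongrightarrow> 0"
    using tendsto_divide_zero[OF summable_LIMSEQ_zero[OF assms(1)]] .
qed

lemma converges_if:
  assumes dist: "\<And>z. z \<in> Z \<Longrightarrow> convergent (\<lambda>n. norm (x n - z))" and residual: "residual \<longlonglongrightarrow> 0"
  shows "residual \<longlonglongrightarrow> 0 \<and> (\<forall>z\<in>Z. (\<lambda>n. B (xbar n)) \<longlonglongrightarrow> B z) \<and> (\<exists>l\<in>Z. weakly_converges x l) \<and>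
    ((\<forall>z\<in>Z. demiregular_at A z \<or> demiregular_at (\<lambda>x. {B x}) z) \<longrightarrow> (\<exists>l\<in>Z. x \<longlonglongrightarrow> l))"
proof -
  have "(\<lambda>n. lam n *\<^sub>R residual n) \<longlonglongrightarrow> 0"
  proof (rule Lim_null_comparison)
    show "\<forall>\<^sub>F n in sequentially. norm (lam n *\<^sub>R residual n) \<le> 2 * norm (residual n)"
      using lam_le_2 lam_pos by (intro always_eventually) (simp add: mult_right_mono less_imp_le)
    show "(\<lambda>n. 2 * norm (residual n)) \<longlonglongrightarrow> 0"
      using tendsto_mult_right_zero[OF tendsto_norm_zero[OF residual]] .
  qed
  moreover have "err \<longlonglongrightarrow> 0"
    using null_of_summable[OF err_summable] by (simp add: tendsto_norm_zero_iff)
  ultimately have "(\<lambda>n. lam n *\<^sub>R residual n + err n) \<longlonglongrightarrow> 0"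
    using tendsto_add by fastforce
  then have step: "(\<lambda>n. x (Suc n) - xbar n) \<longlonglongrightarrow> 0" by (simp add: iteration add.assoc)
  show ?thesis
    using fb_iteration_converges[OF zeros eps_pos gamma dist residual step] residual by blast
qed

lemma mean_diff: "xbar n - z = (\<Sum>j\<le>n. \<mu> n j *\<^sub>R (x j - z))"
  using total[of n] by (simp add: mean scaleR_diff_right sum_subtractf flip: scaleR_sum_left)

text \<open>
  Convexity of the norm bounds \<open>\<parallel>xbar n - z\<parallel>\<close> by the mean \<open>s n\<close> of the distances, which has the
  same limit as the distances by Toeplitz's lemma. The squared residual is therefore bounded by a multiple of
  \<open>(s n)\<^sup>2 - \<parallel>x (Suc n) - z\<parallel>\<^sup>2\<close> up to error terms, and both squares have the same limit.
\<close>
lemma nonneg_weights_converge: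
  assumes nonneg: "\<And>n j. j \<le> n \<Longrightarrow> 0 \<le> \<mu> n j"
  shows "z \<in> Z \<Longrightarrow> convergent (\<lambda>n. norm (x n - z))" and "residual \<longlonglongrightarrow> 0"
proof -
  have mean_le: "norm (xbar n - z) \<le> (\<Sum>j\<le>n. \<mu> n j * norm (x j - z))" for n z
    unfolding mean_diff
    by (rule order_trans[OF norm_sum]) (auto intro!: sum_mono simp: nonneg)
  have step_le: "norm (xbar n + lam n *\<^sub>R residual n - z) \<le> norm (xbar n - z)" if "z \<in> Z" for n z
  proof (rule power2_le_imp_le)
    have "0 \<le> margin * (norm (residual n))\<^sup>2" using margin_pos by simp
    then show "(norm (xbar n + lam n *\<^sub>R residual n - z))\<^sup>2 \<le> (norm (xbar n - z))\<^sup>2"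
      using exact_step_margin[OF that, of n] by linarith
  qed simp
  have x_le: "norm (x (Suc n) - z) \<le> norm (xbar n + lam n *\<^sub>R residual n - z) + norm (err n)" for n z
  proof -
    have "x (Suc n) - z = (xbar n + lam n *\<^sub>R residual n - z) + err n" by (simp add: iteration)
    then show ?thesis by (metis norm_triangle_ineq)
  qed
  show conv: "convergent (\<lambda>n. norm (x n - z))" if "z \<in> Z" for z
  proof (rule concentrating[where e = "\<lambda>n. norm (err n)"])
    show "norm (x (Suc n) - z) \<le> (\<Sum>j\<le>n. \<mu> n j * norm (x j - z)) + norm (err n)" for n
      using x_le[of n z] step_le[OF that, of n] mean_le[of n z] by linarith
  qed (use err_summable in auto)
  obtain z where "z \<in> Z" using zeros by blast
  obtain l where l: "(\<lambda>n. norm (x n - z)) \<longlonglongrightarrow> l"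
    using conv[OF \<open>z \<in> Z\<close>] by (auto simp: convergent_def)
  define s where "s n = (\<Sum>j\<le>n. \<mu> n j * norm (x j - z))" for n
  have s_lim: "s \<longlonglongrightarrow> l"
    unfolding s_def using toeplitz_tendsto[OF bounded total column l] .
  have err_lim: "(\<lambda>n. norm (err n)) \<longlonglongrightarrow> 0"
    using null_of_summable[OF err_summable] by simp
  show "residual \<longlonglongrightarrow> 0"
  proof (rule null_of_square_bound[OF margin_pos])
    fix n
    define y where "y = norm (xbar n + lam n *\<^sub>R residual n - z)"
    have y: "y \<le> s n" using step_le[OF \<open>z \<in> Z\<close>, of n] mean_le[of n z] by (simp add: y_def s_def)
    have "(norm (x (Suc n) - z))\<^sup>2 \<le> (y + norm (err n))\<^sup>2"
      unfolding y_def by (rule power_mono[OF x_le]) simp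
    also have "\<dots> = y\<^sup>2 + 2 * y * norm (err n) + (norm (err n))\<^sup>2"
      by (simp add: power2_sum)
    also have "\<dots> \<le> y\<^sup>2 + 2 * s n * norm (err n) + (norm (err n))\<^sup>2"
      using y by (simp add: mult_right_mono)
    finally have "y\<^sup>2 \<ge> (norm (x (Suc n) - z))\<^sup>2 - 2 * s n * norm (err n) - (norm (err n))\<^sup>2" by simp
    moreover have "(norm (xbar n - z))\<^sup>2 \<le> (s n)\<^sup>2"
      using mean_le[of n z] by (simp add: s_def power_mono)
    ultimately show "margin * (norm (residual n))\<^sup>2 \<le>
        (s n)\<^sup>2 - ((norm (x (Suc n) - z))\<^sup>2 - 2 * s n * norm (err n) - (norm (err n))\<^sup>2)"
      using exact_step_margin[OF \<open>z \<in> Z\<close>, of n] by (simp add: y_def)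
  next
    have "(\<lambda>n. (s n)\<^sup>2 - ((norm (x (Suc n) - z))\<^sup>2 - 2 * s n * norm (err n) - (norm (err n))\<^sup>2))
        \<longlonglongrightarrow> l\<^sup>2 - (l\<^sup>2 - 2 * l * 0 - 0\<^sup>2)"
      by (intro tendsto_intros s_lim LIMSEQ_Suc[OF l] err_lim)
    then show "(\<lambda>n. (s n)\<^sup>2 - ((norm (x (Suc n) - z))\<^sup>2 - 2 * s n * norm (err n) - (norm (err n))\<^sup>2)) \<longlonglongrightarrow> 0"
      by simp
  qed
qed

end

section \<open>Inertial iterations\<close>

lemma zeta_add_Suc: "zeta \<eta> (n + Suc i) n = zeta \<eta> (n + i) n + (\<eta> (Suc (n + i)) - 1)"
  by (simp add: zeta_def)

text \<open>
  Truncated subtraction in \<open>x (n - 1)\<close> encodes \<open>x\<^sub>-\<^sub>1 = x\<^sub>0\<close>; together with \<open>\<eta> 0 = 0\<close> it makes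
  the formulas below valid at \<open>n = 0\<close> as well.
\<close>
locale inertial_forward_backward =
  mean_value_forward_backward A B \<beta> \<epsilon> \<gamma> lam chi \<mu> x xbar "\<lambda>n. 0"
  for A :: "'h::{real_inner, complete_space} operator" and B \<beta> \<epsilon> \<gamma> lam chi \<mu> x xbar +
  fixes \<eta> :: "nat \<Rightarrow> real"
  assumes eta: "\<And>n. 0 \<le> \<eta> n" "\<And>n. \<eta> n < 1" and eta_0: "\<eta> 0 = 0"
    and weights: "\<And>n j. j \<le> n \<Longrightarrow> \<mu> n j = (if j = n then 1 + \<eta> n else if j + 1 = n then - \<eta> n else 0)"
    and chi_sums: "\<And>n. (\<lambda>i. exp (zeta \<eta> (n + i) n)) sums chi n"
begin

abbreviation speed :: "nat \<Rightarrow> real" where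
  "speed n \<equiv> norm (x n - x (n - 1))"

lemma inertial_mean:
  fixes f :: "nat \<Rightarrow> 'v::real_vector"
  shows "(\<Sum>j\<le>n. \<mu> n j *\<^sub>R f j) = f n + \<eta> n *\<^sub>R (f n - f (n - 1))"
proof (cases n)
  case 0
  then show ?thesis using weights[of 0 0] by (simp add: eta_0)
next
  case (Suc m)
  have "(\<Sum>j<m. \<mu> n j *\<^sub>R f j) = 0"
    using weights[of _ n] Suc by (intro sum.neutral) auto
  moreover have "{..n} = insert n (insert m {..<m})" using Suc by auto
  ultimately show ?thesis
    using weights[of n n] weights[of m n] Suc by (simp add: algebra_simps)
qed

lemma inertial_mean_real: "(\<Sum>j\<le>n. \<mu> n j * f j) = f n + \<eta> n * (f n - f (n - 1))"
  using inertial_mean[of n f] by simp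

lemma norm_extrapolation:
  fixes u v :: "'v::real_inner"
  shows "(norm (u + t *\<^sub>R (u - v)))\<^sup>2
    = (norm u)\<^sup>2 + t * ((norm u)\<^sup>2 - (norm v)\<^sup>2) + t * (1 + t) * (norm (u - v))\<^sup>2"
  unfolding power2_norm_eq_inner
  by (simp add: inner_add_left inner_add_right inner_diff_left inner_diff_right inner_commute algebra_simps)

lemma xbar_dist:
  "(norm (xbar n - z))\<^sup>2 = (\<Sum>j\<le>n. \<mu> n j * (norm (x j - z))\<^sup>2) + \<eta> n * (1 + \<eta> n) * (speed n)\<^sup>2"
proof -
  have "xbar n - z = (x n - z) + \<eta> n *\<^sub>R ((x n - z) - (x (n - 1) - z))"
    unfolding mean_diff inertial_mean ..
  then show ?thesis unfolding inertial_mean_real by (simp only: norm_extrapolation) simp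
qed

lemma iteration_exact: "x (Suc n) = xbar n + lam n *\<^sub>R residual n"
  using iteration by simp

text \<open>
  The concentrating property is applied to the squared distances, with perturbations \<open>2 \<eta> n (speed n)\<^sup>2\<close> that
  majorize the cost \<open>\<eta> n (1 + \<eta> n) (speed n)\<^sup>2\<close> of the extrapolation.
\<close>
lemma weighted_speeds_converge:
  assumes "summable (\<lambda>n. chi n * \<eta> n * (speed n)\<^sup>2)"
  shows "z \<in> Z \<Longrightarrow> convergent (\<lambda>n. norm (x n - z))" and "residual \<longlonglongrightarrow> 0"
proof -
  define e where "e n = 2 * \<eta> n * (speed n)\<^sup>2" for n
  have e_nonneg: "0 \<le> e n" for n using eta(1) by (simp add: e_def)
  have e_summable: "summable (\<lambda>n. chi n * e n)"
    using summable_mult[OF assms, of 2] by (simp add: e_def algebra_simps)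
  have step: "(norm (x (Suc n) - z))\<^sup>2 + margin * (norm (residual n))\<^sup>2
      \<le> (\<Sum>j\<le>n. \<mu> n j * (norm (x j - z))\<^sup>2) + e n" if "z \<in> Z" for n z
  proof -
    have "\<eta> n * (1 + \<eta> n) * (speed n)\<^sup>2 \<le> e n"
      using eta[of n] mult_left_mono[of "1 + \<eta> n" 2 "\<eta> n"]
      unfolding e_def by (intro mult_right_mono) (auto simp: mult.commute)
    then show ?thesis using exact_step_margin[OF that, of n] xbar_dist[of n z]
      by (simp add: iteration_exact)
  qed
  have conv2: "convergent (\<lambda>n. (norm (x n - z))\<^sup>2)" if "z \<in> Z" for z
  proof (rule concentrating[OF _ e_nonneg e_summable])
    show "(norm (x (Suc n) - z))\<^sup>2 \<le> (\<Sum>j\<le>n. \<mu> n j * (norm (x j - z))\<^sup>2) + e n" for n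
      using step[OF that, of n] margin_pos zero_le_power2[of "norm (residual n)"]
      by (smt (verit) mult_nonneg_nonneg)
  qed simp
  then show "convergent (\<lambda>n. norm (x n - z))" if "z \<in> Z" for z
    using that tendsto_real_sqrt[of "\<lambda>n. (norm (x n - z))\<^sup>2" _ sequentially]
    by (force simp: convergent_def)
  obtain z where "z \<in> Z" using zeros by blast
  obtain l where l: "(\<lambda>n. (norm (x n - z))\<^sup>2) \<longlonglongrightarrow> l"
    using conv2[OF \<open>z \<in> Z\<close>] by (auto simp: convergent_def)
  show "residual \<longlonglongrightarrow> 0"
  proof (rule null_of_square_bound[OF margin_pos])
    show "margin * (norm (residual n))\<^sup>2
        \<le> (\<Sum>j\<le>n. \<mu> n j * (norm (x j - z))\<^sup>2) + e n - (norm (x (Suc n) - z))\<^sup>2" for n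
      using step[OF \<open>z \<in> Z\<close>, of n] by simp
    have "(\<lambda>n. (\<Sum>j\<le>n. \<mu> n j * (norm (x j - z))\<^sup>2) + e n - (norm (x (Suc n) - z))\<^sup>2) \<longlonglongrightarrow> l + 0 - l"
      by (intro tendsto_intros toeplitz_tendsto[OF bounded total column l] LIMSEQ_Suc[OF l]
          null_of_summable[OF e_summable e_nonneg])
    then show "(\<lambda>n. (\<Sum>j\<le>n. \<mu> n j * (norm (x j - z))\<^sup>2) + e n - (norm (x (Suc n) - z))\<^sup>2) \<longlonglongrightarrow> 0" by simp
  qed
qed

lemma chi_le_bounded_inertia:
  assumes "h < 1" and h: "\<And>n. \<eta> n \<le> h"
  shows "chi n \<le> 1 / (1 - exp (h - 1))"
proof (rule sums_le[OF _ chi_sums geometric_sums])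
  show "exp (zeta \<eta> (n + i) n) \<le> exp (h - 1) ^ i" for i
  proof (induction i)
    case (Suc i)
    have "exp (zeta \<eta> (n + i) n) * exp (\<eta> (Suc (n + i)) - 1) \<le> exp (h - 1) ^ i * exp (h - 1)"
      using Suc h[of "Suc (n + i)"] by (intro mult_mono) auto
    then show ?case by (simp only: zeta_add_Suc exp_add power_Suc2)
  qed (simp add: zeta_def)
qed (use \<open>h < 1\<close> in simp)

text \<open>
  From \<open>exp (- s) \<le> 1 / (1 + s)\<close> each factor \<open>exp (\<eta>\<^sub>j - 1)\<close> is at most \<open>(j + 2) / (j + 4)\<close>. The product of these bounds
  over \<open>n < j \<le> n + i\<close> telescopes, and so does the sum over \<open>i\<close> of the products, to \<open>n + 4\<close>.
\<close>
lemma chi_le_nesterov_inertia: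
  assumes "\<tau> \<ge> 2" and nesterov: "\<And>n. n \<ge> 1 \<Longrightarrow> \<eta> n = (real n - 1) / (real n + \<tau>)"
  shows "chi n \<le> real n + 4"
proof (rule sums_le[OF _ chi_sums])
  define c where "c = (real n + 3) * (real n + 4)"
  define f where "f i = - 1 / (real n + real i + 3)" for i
  have "(\<lambda>i. f (Suc i) - f i) sums (0 - f 0)"
    by (rule telescope_sums) (unfold f_def, real_asymp)
  from sums_mult[OF this, of c]
  show "(\<lambda>i. c * (f (Suc i) - f i)) sums (real n + 4)" by (simp add: f_def c_def)
  show "exp (zeta \<eta> (n + i) n) \<le> c * (f (Suc i) - f i)" for i
  proof -
    have "exp (zeta \<eta> (n + i) n) \<le> c / ((real n + real i + 3) * (real n + real i + 4))"
    proof (induction i)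
      case 0
      show ?case by (simp add: zeta_def c_def)
    next
      case (Suc i)
      define j where "j = real (Suc (n + i))"
      have j: "j \<ge> 1" by (simp add: j_def)
      have "\<eta> (Suc (n + i)) - 1 = - ((1 + \<tau>) / (j + \<tau>))"
        using nesterov[of "Suc (n + i)"] j \<open>\<tau> \<ge> 2\<close> by (simp add: j_def field_simps)
      moreover have "exp (- ((1 + \<tau>) / (j + \<tau>))) \<le> 1 / (1 + (1 + \<tau>) / (j + \<tau>))"
        using exp_ge_add_one_self[of "(1 + \<tau>) / (j + \<tau>)"] j \<open>\<tau> \<ge> 2\<close>
        by (simp add: exp_minus inverse_eq_divide frac_le add_pos_nonneg)
      moreover have "1 / (1 + (1 + \<tau>) / (j + \<tau>)) \<le> (j + 2) / (j + 4)"
      proof -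
        have "(j + \<tau>) * (j + 4) \<le> (j + 2) * (j + 1 + 2 * \<tau>)"
        proof -
          have "1 * j \<le> \<tau> * j" using j \<open>\<tau> \<ge> 2\<close> by (intro mult_right_mono) auto
          moreover have "(j + 2) * (j + 1 + 2 * \<tau>) - (j + \<tau>) * (j + 4) = \<tau> * j - j + 2"
            by (simp add: algebra_simps)
          ultimately show ?thesis by linarith
        qed
        then have "(j + \<tau>) / (j + 1 + 2 * \<tau>) \<le> (j + 2) / (j + 4)"
          using j \<open>\<tau> \<ge> 2\<close> by (simp add: divide_le_eq le_divide_eq field_simps)
        moreover have "1 / (1 + (1 + \<tau>) / (j + \<tau>)) = (j + \<tau>) / (j + 1 + 2 * \<tau>)"
          using j \<open>\<tau> \<ge> 2\<close> by (simp add: field_simps)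
        ultimately show ?thesis by simp
      qed
      ultimately have "exp (\<eta> (Suc (n + i)) - 1) \<le> (j + 2) / (j + 4)" by (metis order_trans)
      then have "exp (zeta \<eta> (n + i) n) * exp (\<eta> (Suc (n + i)) - 1)
          \<le> c / ((real n + real i + 3) * (real n + real i + 4)) * ((j + 2) / (j + 4))"
        using Suc by (intro mult_mono) (auto simp: c_def)
      also have "\<dots> = c / ((real n + real (Suc i) + 3) * (real n + real (Suc i) + 4))"
        by (simp add: j_def divide_simps) (simp add: algebra_simps)
      finally show ?case by (simp only: zeta_add_Suc exp_add)
    qed
    also have "\<dots> = c * (f (Suc i) - f i)" by (simp add: f_def divide_simps)
    finally show ?thesis .
  qed
qed

text \<open>
  The Lyapunov function is \<open>V n = \<xi> n - \<eta> n \<xi> (n - 1) + G n (speed n)\<^sup>2\<close>, where \<open>\<xi> n = \<parallel>x n - z\<parallel>\<^sup>2\<close>. Rewriting the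
  residual as \<open>(x (Suc n) - xbar n) / lam n\<close> and splitting the cross term of
  \<open>\<parallel>x (Suc n) - xbar n\<parallel>\<^sup>2\<close> by Young's inequality with parameter \<open>D n = \<eta> n + \<theta> lam n\<close> turns the decrease of the
  squared distance into a decrease of \<open>V\<close>; the bound on \<open>lam\<close> makes it at
  least \<open>\<sigma> (speed (Suc n))\<^sup>2\<close>. Since \<open>V n \<ge> \<xi> n - h \<xi> (n - 1)\<close> and \<open>h < 1\<close>, the distances are
  bounded, so \<open>V\<close> is bounded below and the squared speeds are summable.
\<close>
lemma speeds_summable_of_lyapunov:
  assumes "\<sigma> > 0" "\<theta> > 0" "0 < h" "h < 1"
    and mono: "\<And>n. \<eta> n \<le> \<eta> (Suc n)" and le_h: "\<And>n. \<eta> n \<le> h"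
    and relaxation: "\<And>n. lam n \<le> (\<theta> * (slack n + lam n) - h * (h * (1 + h) + h * \<theta> * slack (Suc n) + \<sigma>)) /
        (\<theta> * (1 + h * (1 + h) + h * \<theta> * slack (Suc n) + \<sigma>))"
  shows "summable (\<lambda>n. (speed n)\<^sup>2)"
proof -
  obtain z where "z \<in> Z" using zeros by blast
  define \<xi> where "\<xi> n = (norm (x n - z))\<^sup>2" for n
  define D where "D n = \<eta> n + \<theta> * lam n" for n
  define G where "G n = \<eta> n * (1 + \<eta> n) + \<theta> * \<eta> n * slack n" for n
  define V where "V n = \<xi> n - \<eta> n * \<xi> (n - 1) + G n * (speed n)\<^sup>2" for n
  have xi_nonneg: "0 \<le> \<xi> n" for n by (simp add: \<xi>_def)
  have D_pos: "D n > 0" for n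
    using eta(1)[of n] \<open>\<theta> > 0\<close> lam_pos[of n] by (simp add: D_def add_nonneg_pos)
  have young: "(norm (a - t *\<^sub>R b))\<^sup>2 \<ge> (d - t) / d * (norm a)\<^sup>2 - t * (d - t) * (norm b)\<^sup>2"
    if "d > 0" "t \<ge> 0" for a b :: 'h and d t :: real
  proof -
    \<comment> \<open>the defect of the inequality is a multiple of a square\<close>
    have "0 \<le> (t / d) * (norm (a - d *\<^sub>R b))\<^sup>2" using that by simp
    also have "\<dots> = (norm (a - t *\<^sub>R b))\<^sup>2 - ((d - t) / d * (norm a)\<^sup>2 - t * (d - t) * (norm b)\<^sup>2)"
      using that unfolding power2_norm_eq_inner
      by (simp add: inner_diff_left inner_diff_right inner_commute field_simps)
    finally show ?thesis by simp
  qed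
  have step: "\<xi> (Suc n) \<le> \<xi> n + \<eta> n * (\<xi> n - \<xi> (n - 1)) + G n * (speed n)\<^sup>2 - slack n * \<theta> / D n * (speed (Suc n))\<^sup>2" for n
  proof -
    have eq: "x (Suc n) - xbar n = (x (Suc n) - x n) - \<eta> n *\<^sub>R (x n - x (n - 1))"
      unfolding mean inertial_mean by simp
    have "(D n - \<eta> n) / D n * (speed (Suc n))\<^sup>2 - \<eta> n * (D n - \<eta> n) * (speed n)\<^sup>2
        \<le> (norm (x (Suc n) - xbar n))\<^sup>2"
      using young[OF D_pos[of n] eta(1)[of n], of "x (Suc n) - x n" "x n - x (n - 1)"]
      by (simp only: eq diff_Suc_1)
    also have "\<dots> = (lam n)\<^sup>2 * (norm (residual n))\<^sup>2"
      by (simp add: iteration_exact power_mult_distrib)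
    finally have "slack n / lam n * ((D n - \<eta> n) / D n * (speed (Suc n))\<^sup>2 - \<eta> n * (D n - \<eta> n) * (speed n)\<^sup>2)
        \<le> slack n / lam n * ((lam n)\<^sup>2 * (norm (residual n))\<^sup>2)"
      using slack_pos[of n] lam_pos[of n] by (intro mult_left_mono) auto
    moreover have "slack n / lam n * ((D n - \<eta> n) / D n * (speed (Suc n))\<^sup>2 - \<eta> n * (D n - \<eta> n) * (speed n)\<^sup>2)
        = slack n * \<theta> / D n * (speed (Suc n))\<^sup>2 - \<theta> * \<eta> n * slack n * (speed n)\<^sup>2"
      using lam_pos[of n] D_pos[of n] by (simp add: D_def right_diff_distrib)
    moreover have "slack n / lam n * ((lam n)\<^sup>2 * (norm (residual n))\<^sup>2) = lam n * slack n * (norm (residual n))\<^sup>2"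
      using lam_pos[of n] by (simp add: power2_eq_square)
    moreover have "\<xi> (Suc n) \<le> \<xi> n + \<eta> n * (\<xi> n - \<xi> (n - 1)) + \<eta> n * (1 + \<eta> n) * (speed n)\<^sup>2
        - lam n * slack n * (norm (residual n))\<^sup>2"
      using exact_step[OF \<open>z \<in> Z\<close>, of n] xbar_dist[of n z] unfolding inertial_mean_real \<xi>_def
      by (simp add: iteration_exact)
    ultimately show ?thesis by (simp add: G_def distrib_right)
  qed
  have dissipation: "G (Suc n) + \<sigma> \<le> slack n * \<theta> / D n" for n
  proof -
    define H where "H = h * (1 + h) + h * \<theta> * slack (Suc n) + \<sigma>"
    have "H > 0" using assms(1-4) slack_pos[of "Suc n"] by (simp add: H_def add_nonneg_pos)
    have "lam n * (\<theta> * (1 + H)) \<le> \<theta> * (slack n + lam n) - h * H"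
      using relaxation[of n] \<open>H > 0\<close> \<open>\<theta> > 0\<close> by (simp add: H_def pos_le_divide_eq add.assoc)
    then have "(h + \<theta> * lam n) * H \<le> slack n * \<theta>" by (simp add: algebra_simps)
    moreover have "D n * H \<le> (h + \<theta> * lam n) * H"
      using le_h[of n] \<open>H > 0\<close> by (simp add: D_def)
    ultimately have "H \<le> slack n * \<theta> / D n" using D_pos[of n] by (simp add: pos_le_divide_eq mult.commute)
    moreover have "G (Suc n) + \<sigma> \<le> H"
    proof -
      have "\<eta> (Suc n) * (1 + \<eta> (Suc n)) \<le> h * (1 + h)"
        using eta(1)[of "Suc n"] le_h[of "Suc n"] by (intro mult_mono) auto
      moreover have "\<theta> * \<eta> (Suc n) * slack (Suc n) \<le> h * \<theta> * slack (Suc n)"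
        using le_h[of "Suc n"] \<open>\<theta> > 0\<close> slack_pos[of "Suc n"] by (simp add: mult.commute)
      ultimately show ?thesis by (simp add: G_def H_def)
    qed
    ultimately show ?thesis by simp
  qed
  have V_step: "V (Suc n) + \<sigma> * (speed (Suc n))\<^sup>2 \<le> V n" for n
  proof -
    have "(G (Suc n) + \<sigma>) * (speed (Suc n))\<^sup>2 \<le> slack n * \<theta> / D n * (speed (Suc n))\<^sup>2"
      by (rule mult_right_mono[OF dissipation]) simp
    moreover have "\<eta> n * \<xi> n \<le> \<eta> (Suc n) * \<xi> n"
      using mono[of n] by (intro mult_right_mono) (simp_all add: \<xi>_def)
    ultimately show ?thesis using step[of n] by (simp add: V_def algebra_simps)
  qed
  have V_0: "V 0 = \<xi> 0" by (simp add: V_def eta_0)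
  have sum_le: "\<sigma> * (\<Sum>k<n. (speed (Suc k))\<^sup>2) \<le> \<xi> 0 - V n" for n
  proof (induction n)
    case (Suc n)
    then show ?case using V_step[of n] by (simp add: distrib_left)
  qed (simp add: V_0)
  have V_ge: "\<xi> n - h * \<xi> (n - 1) \<le> V n" for n
  proof -
    have "\<eta> n * \<xi> (n - 1) \<le> h * \<xi> (n - 1)"
      using le_h[of n] by (intro mult_right_mono) (simp_all add: \<xi>_def)
    moreover have "0 \<le> G n * (speed n)\<^sup>2"
      using eta(1)[of n] \<open>\<theta> > 0\<close> slack_pos[of n] by (simp add: G_def)
    ultimately show ?thesis by (simp add: V_def)
  qed
  have V_le: "V n \<le> \<xi> 0" for n
  proof -
    have "0 \<le> \<sigma> * (\<Sum>k<n. (speed (Suc k))\<^sup>2)" using \<open>\<sigma> > 0\<close> by (simp add: sum_nonneg)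
    then show ?thesis using sum_le[of n] by simp
  qed
  \<comment> \<open>the fixed point of the recursion \<open>t \<mapsto> h t + \<xi> 0\<close>, which dominates the squared distances\<close>
  define K where "K = \<xi> 0 / (1 - h)"
  have K: "h * K + \<xi> 0 = K" using \<open>h < 1\<close> by (simp add: K_def field_simps)
  have xi_le: "\<xi> n \<le> K" for n
  proof (induction n)
    case 0
    have "0 \<le> h * K" using \<open>0 < h\<close> \<open>h < 1\<close> by (simp add: K_def \<xi>_def)
    then show ?case using K by linarith
  next
    case (Suc n)
    have "h * \<xi> n \<le> h * K" using Suc \<open>0 < h\<close> by simp
    then show ?case using V_ge[of "Suc n"] V_le[of "Suc n"] K by simp
  qed
  have "summable (\<lambda>k. (speed (Suc k))\<^sup>2)"
  proof (rule bounded_imp_summable)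
    show "(\<Sum>k\<le>n. (speed (Suc k))\<^sup>2) \<le> (\<xi> 0 + h * K) / \<sigma>" for n
    proof -
      have "h * \<xi> (Suc n - 1) \<le> h * K" using xi_le \<open>0 < h\<close> by simp
      then have "- V (Suc n) \<le> h * K"
        using V_ge[of "Suc n"] xi_nonneg[of "Suc n"] by linarith
      then show ?thesis using sum_le[of "Suc n"] \<open>\<sigma> > 0\<close>
        by (simp add: pos_le_divide_eq mult.commute lessThan_Suc_atMost)
    qed
  qed simp
  then show ?thesis using summable_Suc_iff[of "\<lambda>n. (speed n)\<^sup>2"] by simp
qed

end

section \<open>Convergence of the mean value forward-backward method\<close>

theorem proposition4p9:
  fixes A :: "'h::{real_inner, complete_space} operator"
    and B :: "'h \<Rightarrow> 'h"
    and \<beta> \<epsilon> :: real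
    and \<gamma> lam \<phi> chi :: "nat \<Rightarrow> real"
    and \<mu> :: "nat \<Rightarrow> nat \<Rightarrow> real"
    and a b x xbar :: "nat \<Rightarrow> 'h"
    and x0 :: 'h
  assumes beta: "\<beta> > 0"
    and eps: "0 < \<epsilon>" "\<epsilon> < min (1/2) \<beta>"
    and A: "maximally_monotone A"
    and B: "cocoercive \<beta> B"
    and gamma: "\<forall>n. \<gamma> n \<in> {\<epsilon> .. 2 * \<beta> / (1 + \<epsilon>)}"
    and A1: "bdd_above (range (\<lambda>n. \<Sum>j\<le>n. \<bar>\<mu> n j\<bar>))"
    and A2: "\<forall>n. (\<Sum>j\<le>n. \<mu> n j) = 1"
    and A3: "\<forall>j. (\<lambda>n. \<mu> n j) \<longlonglongrightarrow> 0"
    and A4: "\<forall>n. chi n > 0" "(INF n. chi n) > 0"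
      "\<forall>\<xi> :: nat \<Rightarrow> real. (\<forall>n. \<xi> n \<ge> 0) \<and>
         (\<exists>e :: nat \<Rightarrow> real. (\<forall>n. e n \<ge> 0) \<and> summable (\<lambda>n. chi n * e n) \<and>
            (\<forall>n. \<xi> (n + 1) \<le> (\<Sum>j\<le>n. \<mu> n j * \<xi> j) + e n))
         \<longrightarrow> convergent \<xi>"
    and a_summable: "summable (\<lambda>n. chi n * norm (a n))"
    and b_summable: "summable (\<lambda>n. chi n * norm (b n))"
    and zer_nonempty: "zer (op_add A (\<lambda>x. {B x})) \<noteq> {}"
    and lam: "\<forall>n. lam n \<in> {\<epsilon> .. 1 + (1 - \<epsilon>) * (1 - \<gamma> n / (2 * \<beta>))}"
    and phi: "\<forall>n. \<phi> n = 2 / (4 - \<gamma> n / \<beta>)"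
    and init: "x 0 = x0"
    and xbar: "\<forall>n. xbar n = (\<Sum>j\<le>n. \<mu> n j *\<^sub>R x j)"
    and iteration: "\<forall>n. x (n + 1) = xbar n + lam n *\<^sub>R
          (resolvent (op_scale (\<gamma> n) A) (xbar n - \<gamma> n *\<^sub>R (B (xbar n) + b n)) + a n - xbar n)"
    and cases_ab:
      "(INF n. MIN j\<in>{..n}. \<mu> n j) \<ge> 0
       \<or>
       (\<forall>n. a n = 0 \<and> b n = 0) \<and>
       (\<exists>\<eta> :: nat \<Rightarrow> real. (\<forall>n. \<eta> n \<in> {0..<1}) \<and> \<eta> 0 = 0 \<and>
          (\<forall>n. \<forall>j\<le>n. \<mu> n j = (if j = n then 1 + \<eta> n else if j + 1 = n then - \<eta> n else 0)) \<and>
          (\<forall>n. (\<lambda>i. exp (zeta \<eta> (n + i) n)) sums chi n) \<and>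
          (\<comment> \<open>\<open>n - 1\<close> is truncated: for \<open>n = 0\<close> it encodes the convention \<open>x\<^sub>-\<^sub>1 = x\<^sub>0\<close>\<close>
           summable (\<lambda>n. chi n * \<eta> n * (norm (x n - x (n - 1)))\<^sup>2)
           \<or>
           summable (\<lambda>n. real n * (norm (x n - x (n - 1)))\<^sup>2) \<and>
           (\<exists>\<tau>\<ge>2. \<forall>n\<ge>1. \<eta> n = (real n - 1) / (real n + \<tau>))
           \<or>
           summable (\<lambda>n. \<eta> n * (norm (x n - x (n - 1)))\<^sup>2) \<and>
           (\<exists>h\<in>{0..<1}. \<forall>n. \<eta> n \<le> h)
           \<or>
           (\<exists>\<omega> :: nat \<Rightarrow> real. (\<forall>n. \<omega> n = 1 / \<phi> n - lam n) \<and>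
             (\<exists>\<sigma>>0. \<exists>\<theta>>0. \<exists>h\<in>{0<..<1}. \<forall>n.
                \<eta> n \<le> \<eta> (n + 1) \<and> \<eta> (n + 1) \<le> h \<and>
                lam n \<le> (\<theta> / \<phi> n - h * (h * (1 + h) + h * \<theta> * \<omega> (n + 1) + \<sigma>)) /
                         (\<theta> * (1 + h * (1 + h) + h * \<theta> * \<omega> (n + 1) + \<sigma>)) \<and>
                (h\<^sup>2 * (1 + h) + h * \<sigma>) / \<theta> < 1 / \<phi> n - h\<^sup>2 * \<omega> (n + 1)))))"
  shows
    "((\<lambda>n. resolvent (op_scale (\<gamma> n) A) (xbar n - \<gamma> n *\<^sub>R B (xbar n)) - xbar n) \<longlonglongrightarrow> 0) \<and>
     (\<forall>z \<in> zer (op_add A (\<lambda>x. {B x})). (\<lambda>n. B (xbar n)) \<longlonglongrightarrow> B z) \<and>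
     (\<exists>l \<in> zer (op_add A (\<lambda>x. {B x})). weakly_converges x l) \<and>
     ((\<forall>z \<in> zer (op_add A (\<lambda>x. {B x})). demiregular_at A z \<or> demiregular_at (\<lambda>x. {B x}) z)
        \<longrightarrow> (\<exists>l \<in> zer (op_add A (\<lambda>x. {B x})). x \<longlonglongrightarrow> l))"
proof -
  interpret forward_backward A B \<beta> by unfold_locales (fact A B beta)+
  have zeros: "Z \<noteq> {}" using zer_nonempty by (simp add: Z_def)
  have gamma': "\<epsilon> \<le> \<gamma> n" "\<gamma> n \<le> 2 * \<beta> / (1 + \<epsilon>)" for n using gamma by auto
  have lam': "\<epsilon> \<le> lam n" "lam n \<le> 1 + (1 - \<epsilon>) * (1 - \<gamma> n / (2 * \<beta>))" for n using lam by auto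
  have gamma_pos: "\<gamma> n > 0" for n using gamma'(1)[of n] eps(1) by linarith
  have concentrating: "convergent \<xi>" if "\<And>n. 0 \<le> \<xi> n" "\<And>n. 0 \<le> e n"
      "summable (\<lambda>n. chi n * e n)" "\<And>n. \<xi> (Suc n) \<le> (\<Sum>j\<le>n. \<mu> n j * \<xi> j) + e n"
    for \<xi> e :: "nat \<Rightarrow> real"
    using A4(3)[rule_format, of \<xi>] that by auto
  \<comment> \<open>both errors pass through the relaxation; the one in \<open>B\<close> is contracted by the resolvent\<close>
  define err where "err n = lam n *\<^sub>R (resolvent (op_scale (\<gamma> n) A) (xbar n - \<gamma> n *\<^sub>R (B (xbar n) + b n))
      - fb (\<gamma> n) (xbar n) + a n)" for n
  have iteration': "x (Suc n) = xbar n + lam n *\<^sub>R (fb (\<gamma> n) (xbar n) - xbar n) + err n" for n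
    using iteration by (simp add: err_def algebra_simps)
  have err_le: "norm (err n) \<le> 2 * (2 * \<beta> * norm (b n) + norm (a n))" for n
  proof -
    have "\<gamma> n \<le> 2 * \<beta>"
    proof -
      have "2 * \<beta> / (1 + \<epsilon>) \<le> 2 * \<beta> / 1" using beta eps(1) by (intro divide_left_mono) auto
      then show ?thesis using gamma'(2)[of n] by simp
    qed
    have "(1 - \<epsilon>) * (1 - \<gamma> n / (2 * \<beta>)) \<le> 1 * 1"
      using eps gamma_pos[of n] beta \<open>\<gamma> n \<le> 2 * \<beta>\<close> by (intro mult_mono) auto
    then have "lam n \<le> 2" using lam'(2)[of n] by linarith
    have "norm (resolvent (op_scale (\<gamma> n) A) (xbar n - \<gamma> n *\<^sub>R (B (xbar n) + b n)) - fb (\<gamma> n) (xbar n))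
        \<le> norm (\<gamma> n *\<^sub>R b n)"
      using resolvent_nonexpansive[OF A gamma_pos[of n], of "xbar n - \<gamma> n *\<^sub>R (B (xbar n) + b n)"
          "xbar n - \<gamma> n *\<^sub>R B (xbar n)"]
      by (simp add: fb_def scaleR_add_right)
    also have "\<dots> \<le> 2 * \<beta> * norm (b n)"
      using gamma_pos[of n] \<open>\<gamma> n \<le> 2 * \<beta>\<close> by (simp add: mult_right_mono)
    finally have "norm (resolvent (op_scale (\<gamma> n) A) (xbar n - \<gamma> n *\<^sub>R (B (xbar n) + b n)) - fb (\<gamma> n) (xbar n) + a n)
        \<le> 2 * \<beta> * norm (b n) + norm (a n)"
      using norm_triangle_ineq order_trans add_right_mono by blast
    then show ?thesis
      using lam'(1)[of n] eps(1) \<open>lam n \<le> 2\<close> beta unfolding err_def norm_scaleR by (intro mult_mono) auto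
  qed
  have err_summable: "summable (\<lambda>n. chi n * norm (err n))"
  proof (rule summable_comparison_test')
    show "summable (\<lambda>n. 4 * \<beta> * (chi n * norm (b n)) + 2 * (chi n * norm (a n)))"
      by (intro summable_add summable_mult a_summable b_summable)
    show "norm (chi n * norm (err n)) \<le> 4 * \<beta> * (chi n * norm (b n)) + 2 * (chi n * norm (a n))" for n
      using mult_left_mono[OF err_le[of n], of "chi n"] A4(1)[rule_format, of n] by (simp add: algebra_simps)
  qed
  have total: "(\<Sum>j\<le>n. \<mu> n j) = 1" and mean: "xbar n = (\<Sum>j\<le>n. \<mu> n j *\<^sub>R x j)"
    and column: "(\<lambda>n. \<mu> n j) \<longlonglongrightarrow> 0" and chi_pos: "chi n > 0" for n j
    using A2 A3 A4(1) xbar by blast+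
  have mean_value: "mean_value_forward_backward A B \<beta> \<epsilon> \<gamma> lam chi \<mu> x xbar err"
    by unfold_locales
      (fact eps(1) gamma' lam' A1 total column chi_pos A4(2) concentrating zeros mean iteration' err_summable)+
  show ?thesis
    using cases_ab
  proof (elim disjE[where P = "(INF n. MIN j\<in>{..n}. \<mu> n j) \<ge> 0"] conjE exE)
    assume "(INF n. MIN j\<in>{..n}. \<mu> n j) \<ge> 0"
    interpret mean_value_forward_backward A B \<beta> \<epsilon> \<gamma> lam chi \<mu> x xbar err
      by (rule mean_value)
    have "0 \<le> \<mu> n j" if "j \<le> n" for n j
    proof -
      obtain S where S: "\<And>n. (\<Sum>j\<le>n. \<bar>\<mu> n j\<bar>) \<le> S" using A1 by (auto simp: bdd_above_def)
      \<comment> \<open>needed for the infimum to be a genuine lower bound of the row minima\<close>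
      have entry: "- S \<le> \<mu> m i" if "i \<le> m" for m i
        using member_le_sum[of i "{..m}" "\<lambda>i. \<bar>\<mu> m i\<bar>"] that S[of m] by simp
      have "bdd_below (range (\<lambda>n. MIN j\<in>{..n}. \<mu> n j))"
        by (rule bdd_belowI[of _ "- S"]) (auto simp: entry)
      then have "(INF n. MIN j\<in>{..n}. \<mu> n j) \<le> (MIN j\<in>{..n}. \<mu> n j)" by (rule cINF_lower) simp
      also have "\<dots> \<le> \<mu> n j" using that by (intro Min_le) auto
      finally show ?thesis using \<open>(INF n. MIN j\<in>{..n}. \<mu> n j) \<ge> 0\<close> by linarith
    qed
    from nonneg_weights_converge[OF this] show ?thesis
      using converges_if by (simp add: fb_def Z_def)
  next
    fix \<eta> :: "nat \<Rightarrow> real"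
    assume no_error: "\<forall>n. a n = 0 \<and> b n = 0"
      and inertia: "\<forall>n. \<eta> n \<in> {0..<1}" "\<eta> 0 = 0"
      and weights: "\<forall>n. \<forall>j\<le>n. \<mu> n j = (if j = n then 1 + \<eta> n else if j + 1 = n then - \<eta> n else 0)"
      and chi_sums: "\<forall>n. (\<lambda>i. exp (zeta \<eta> (n + i) n)) sums chi n"
      and speeds: "summable (\<lambda>n. chi n * \<eta> n * (norm (x n - x (n - 1)))\<^sup>2)
        \<or> summable (\<lambda>n. real n * (norm (x n - x (n - 1)))\<^sup>2) \<and>
           (\<exists>\<tau>\<ge>2. \<forall>n\<ge>1. \<eta> n = (real n - 1) / (real n + \<tau>))
        \<or> summable (\<lambda>n. \<eta> n * (norm (x n - x (n - 1)))\<^sup>2) \<and> (\<exists>h\<in>{0..<1}. \<forall>n. \<eta> n \<le> h)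
        \<or> (\<exists>\<omega> :: nat \<Rightarrow> real. (\<forall>n. \<omega> n = 1 / \<phi> n - lam n) \<and>
             (\<exists>\<sigma>>0. \<exists>\<theta>>0. \<exists>h\<in>{0<..<1}. \<forall>n.
                \<eta> n \<le> \<eta> (n + 1) \<and> \<eta> (n + 1) \<le> h \<and>
                lam n \<le> (\<theta> / \<phi> n - h * (h * (1 + h) + h * \<theta> * \<omega> (n + 1) + \<sigma>)) /
                         (\<theta> * (1 + h * (1 + h) + h * \<theta> * \<omega> (n + 1) + \<sigma>)) \<and>
                (h\<^sup>2 * (1 + h) + h * \<sigma>) / \<theta> < 1 / \<phi> n - h\<^sup>2 * \<omega> (n + 1)))"
    have err_0: "err = (\<lambda>n. 0)" using no_error by (simp add: fun_eq_iff err_def fb_def)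
    interpret inertial_forward_backward A B \<beta> \<epsilon> \<gamma> lam chi \<mu> x xbar \<eta>
      by (intro inertial_forward_backward.intro inertial_forward_backward_axioms.intro
          mean_value[unfolded err_0]) (use inertia weights chi_sums in auto)
    have bounded_inertia: "summable (\<lambda>n. chi n * \<eta> n * (speed n)\<^sup>2)"
      if h: "h < 1" "\<And>n. \<eta> n \<le> h" and sum: "summable (\<lambda>n. \<eta> n * (speed n)\<^sup>2)" for h
    proof (rule summable_comparison_test'[OF summable_mult[OF sum]])
      show "norm (chi n * \<eta> n * (speed n)\<^sup>2) \<le> 1 / (1 - exp (h - 1)) * (\<eta> n * (speed n)\<^sup>2)" for n
        using mult_right_mono[OF chi_le_bounded_inertia[OF h, of n], of "\<eta> n * (speed n)\<^sup>2"]
          chi_pos[of n] eta(1)[of n]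
        by (simp add: abs_mult mult.assoc)
    qed
    have "summable (\<lambda>n. chi n * \<eta> n * (speed n)\<^sup>2)"
      using speeds
    proof (elim disjE)
      assume "summable (\<lambda>n. real n * (speed n)\<^sup>2) \<and> (\<exists>\<tau>\<ge>2. \<forall>n\<ge>1. \<eta> n = (real n - 1) / (real n + \<tau>))"
      then obtain \<tau> where sum: "summable (\<lambda>n. real n * (speed n)\<^sup>2)"
        and \<tau>: "\<tau> \<ge> 2" "\<And>n. n \<ge> 1 \<Longrightarrow> \<eta> n = (real n - 1) / (real n + \<tau>)" by auto
      show ?thesis
      proof (rule summable_comparison_test'[OF summable_mult[OF sum]])
        fix n
        have "chi n * \<eta> n \<le> 5 * real n"
        proof (cases n)
          case (Suc m)
          have "chi n * \<eta> n \<le> (real n + 4) * 1"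
            using chi_le_nesterov_inertia[OF \<tau>, of n] chi_pos[of n] eta[of n]
            by (intro mult_mono) (auto intro: less_imp_le)
          then show ?thesis using Suc by simp
        qed (simp add: eta_0)
        from mult_right_mono[OF this, of "(speed n)\<^sup>2"]
        show "norm (chi n * \<eta> n * (speed n)\<^sup>2) \<le> 5 * (real n * (speed n)\<^sup>2)"
          using chi_pos[of n] eta(1) by (simp add: abs_mult mult.assoc)
      qed
    next
      assume "summable (\<lambda>n. \<eta> n * (speed n)\<^sup>2) \<and> (\<exists>h\<in>{0..<1}. \<forall>n. \<eta> n \<le> h)"
      then show ?thesis using bounded_inertia by auto
    next
      assume "\<exists>\<omega> :: nat \<Rightarrow> real. (\<forall>n. \<omega> n = 1 / \<phi> n - lam n) \<and>
             (\<exists>\<sigma>>0. \<exists>\<theta>>0. \<exists>h\<in>{0<..<1}. \<forall>n.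
                \<eta> n \<le> \<eta> (n + 1) \<and> \<eta> (n + 1) \<le> h \<and>
                lam n \<le> (\<theta> / \<phi> n - h * (h * (1 + h) + h * \<theta> * \<omega> (n + 1) + \<sigma>)) /
                         (\<theta> * (1 + h * (1 + h) + h * \<theta> * \<omega> (n + 1) + \<sigma>)) \<and>
                (h\<^sup>2 * (1 + h) + h * \<sigma>) / \<theta> < 1 / \<phi> n - h\<^sup>2 * \<omega> (n + 1))"
      then obtain \<omega> :: "nat \<Rightarrow> real" and \<sigma> \<theta> h where \<omega>: "\<And>n. \<omega> n = 1 / \<phi> n - lam n"
        and pos: "\<sigma> > 0" "\<theta> > 0" "0 < h" "h < 1"
        and mono: "\<And>n. \<eta> n \<le> \<eta> (Suc n)" and le_h: "\<And>n. \<eta> (Suc n) \<le> h"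
        and relaxation: "\<And>n. lam n \<le> (\<theta> / \<phi> n - h * (h * (1 + h) + h * \<theta> * \<omega> (Suc n) + \<sigma>)) /
            (\<theta> * (1 + h * (1 + h) + h * \<theta> * \<omega> (Suc n) + \<sigma>))"
        by (auto simp del: times_divide_eq_right)
      have slack: "1 / \<phi> n = slack n + lam n" for n
        using phi by (simp add: slack_def diff_divide_distrib)
      have "\<omega> n = slack n" for n by (simp add: \<omega> slack)
      moreover have "\<theta> / \<phi> n = \<theta> * (slack n + lam n)" for n using slack[of n] by (simp add: divide_inverse)
      ultimately have "summable (\<lambda>n. (speed n)\<^sup>2)"
        using relaxation order_trans[OF mono le_h] by (intro speeds_summable_of_lyapunov[OF pos mono]) auto
      then have "summable (\<lambda>n. \<eta> n * (speed n)\<^sup>2)"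
        by (rule summable_comparison_test')
          (use eta(1) less_imp_le[OF eta(2)] in \<open>auto simp: abs_mult intro!: mult_left_le_one_le\<close>)
      then show ?thesis using bounded_inertia[OF \<open>h < 1\<close> order_trans[OF mono le_h]] by blast
    qed
    from weighted_speeds_converge[OF this] show ?thesis
      using converges_if by (simp add: fb_def Z_def)
  qed
qed

end
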